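(* Let $\mathfrak g$ be a simple Lie algebra and $\alpha\in\Pi$ a simple root. If $\mathfrak a\subset\mathfrak g_\alpha(1)$ is an abelian subspace and $\dim\mathfrak a=\frac12\dim\mathfrak g_\alpha(1)$, then there is an abelian subspace $\tilde{\mathfrak a}\subset\mathfrak g_\alpha(1)$ such that $\mathfrak a\oplus\tilde{\mathfrak a}=\mathfrak g_\alpha(1)$ (direct sum of vector spaces).
   Context: The ground field $\Bbbk$ is algebraically closed of characteristic $0$. $\mathfrak g$ is a simple Lie algebra with Cartan subalgebra $\mathfrak t$, root system $\Delta$, positive roots $\Delta^+$, simple roots $\Pi$. For $\gamma=\sum_{\beta\in\Pi}n_\beta\beta\in\Delta$ put $\mathsf{ht}_\alpha(\gamma)=n_\alpha$ and $\Delta_\alpha(i)=\{\gamma\in\Delta\mid \mathsf{ht}_\alpha(\gamma)=i\}$. The $(\mathbb Z,\alpha)$-grading is $\mathfrak g=\bigoplus_{i}\mathfrak g_\alpha(i)$ with $\mathfrak g_\alpha(0)=\mathfrak t\oplus\bigoplus_{\gamma\in\Delta_\alpha(0)}\mathfrak g^\gamma$ and $\mathfrak g_\alpha(i)=\bigoplus_{\gamma\in\Delta_\alpha(i)}\mathfrak g^\gamma$ for $i\ne0$, where $\mathfrak g^\gamma$ is the root space. An abelian subspace is a linear subspace $\mathfrak a\subset\mathfrak g_\alpha(1)$ with $[\mathfrak a,\mathfrak a]=0$. *)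

theory Defs
  imports
    "HOL-Computational_Algebra.Computational_Algebra"
    "HOL-Library.Function_Algebras"
begin

definition is_direct_sum :: "'g::ab_group_add set \<Rightarrow> 'g set \<Rightarrow> 'g set \<Rightarrow> bool" where
  "is_direct_sum U W V \<longleftrightarrow> U \<inter> W = {0} \<and> {u + w | u w. u \<in> U \<and> w \<in> W} = V"

locale lie_algebra = vector_space scale
  for scale :: "'k::field \<Rightarrow> 'g::ab_group_add \<Rightarrow> 'g" (infixr "*s" 75) +
  fixes bracket :: "'g \<Rightarrow> 'g \<Rightarrow> 'g"
  assumes bracket_add_left: "bracket (x + y) z = bracket x z + bracket y z"
    and bracket_add_right: "bracket x (y + z) = bracket x y + bracket x z"
    and bracket_scale_left: "bracket (c *s x) y = c *s bracket x y"
    and bracket_scale_right: "bracket x (c *s y) = c *s bracket x y"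
    and bracket_self: "bracket x x = 0"
    and jacobi: "bracket x (bracket y z) + bracket y (bracket z x) + bracket z (bracket x y) = 0"
begin

definition lie_subalgebra :: "'g set \<Rightarrow> bool" where
  "lie_subalgebra S \<longleftrightarrow> subspace S \<and> (\<forall>x\<in>S. \<forall>y\<in>S. bracket x y \<in> S)"

definition lie_ideal :: "'g set \<Rightarrow> bool" where
  "lie_ideal I \<longleftrightarrow> subspace I \<and> (\<forall>x. \<forall>y\<in>I. bracket x y \<in> I)"

primrec lower_central :: "'g set \<Rightarrow> nat \<Rightarrow> 'g set" where
  "lower_central S 0 = S"
| "lower_central S (Suc n) = span {bracket x y | x y. x \<in> S \<and> y \<in> lower_central S n}"

definition nilpotent_subalgebra :: "'g set \<Rightarrow> bool" where
  "nilpotent_subalgebra S \<longleftrightarrow> lie_subalgebra S \<and> (\<exists>n. lower_central S n = {0})"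

definition normalizer :: "'g set \<Rightarrow> 'g set" where
  "normalizer S = {x. \<forall>y\<in>S. bracket x y \<in> S}"

definition cartan_subalgebra :: "'g set \<Rightarrow> bool" where
  "cartan_subalgebra T \<longleftrightarrow> nilpotent_subalgebra T \<and> normalizer T = T"

text \<open>
  A linear functional on a subspace \<open>T\<close> is represented by its extension by \<open>0\<close> outside
  \<open>T\<close> (in general not a linear map on the whole space), so that functionals on \<open>T\<close> are equal
  as functions iff they agree on \<open>T\<close>, and are added and scaled pointwise.
\<close>

definition dual_space :: "'g set \<Rightarrow> ('g \<Rightarrow> 'k) set" where
  "dual_space T = {f. (\<forall>x\<in>T. \<forall>y\<in>T. f (x + y) = f x + f y) \<and>
     (\<forall>c. \<forall>x\<in>T. f (c *s x) = c * f x) \<and> (\<forall>x. x \<notin> T \<longrightarrow> f x = 0)}"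

definition root_space :: "'g set \<Rightarrow> ('g \<Rightarrow> 'k) \<Rightarrow> 'g set" where
  "root_space T \<gamma> = {x. \<forall>h\<in>T. bracket h x = \<gamma> h *s x}"

definition roots :: "'g set \<Rightarrow> ('g \<Rightarrow> 'k) set" where
  "roots T = {\<gamma> \<in> dual_space T. \<gamma> \<noteq> 0 \<and> root_space T \<gamma> \<noteq> {0}}"

end

text \<open>
  The integer coefficients of \<open>\<gamma> = (\<Sum>\<beta>\<in>B. n\<^sub>\<beta> \<beta>)\<close>, extended by \<open>0\<close> outside \<open>B\<close>.
\<close>

definition is_root_expansion ::
    "('g \<Rightarrow> 'k::field) set \<Rightarrow> ('g \<Rightarrow> 'k) \<Rightarrow> (('g \<Rightarrow> 'k) \<Rightarrow> int) \<Rightarrow> bool" where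
  "is_root_expansion B \<gamma> n \<longleftrightarrow>
     (\<forall>\<beta>. \<beta> \<notin> B \<longrightarrow> n \<beta> = 0) \<and> \<gamma> = (\<Sum>\<beta>\<in>B. (\<lambda>h. of_int (n \<beta>) * \<beta> h))"

text \<open>
  The expansion is unique when \<open>B\<close> is linearly independent and the characteristic is \<open>0\<close>.
\<close>

definition height ::
    "('g \<Rightarrow> 'k::field) set \<Rightarrow> ('g \<Rightarrow> 'k) \<Rightarrow> ('g \<Rightarrow> 'k) \<Rightarrow> int" where
  "height B \<alpha> \<gamma> = (THE n. is_root_expansion B \<gamma> n) \<alpha>"

context lie_algebra
begin

text \<open>
  \<open>B\<close> is the set of simple roots for some choice of positive roots; the latter are the roots
  with non-negative coefficients.
\<close>

definition simple_roots :: "'g set \<Rightarrow> ('g \<Rightarrow> 'k) set \<Rightarrow> bool" where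
  "simple_roots T B \<longleftrightarrow> finite B \<and> B \<subseteq> roots T \<and>
     \<not> module.dependent (\<lambda>c f h. c * f h) B \<and>
     (\<forall>\<gamma>\<in>roots T. \<exists>n. is_root_expansion B \<gamma> n \<and> ((\<forall>\<beta>\<in>B. n \<beta> \<ge> 0) \<or> (\<forall>\<beta>\<in>B. n \<beta> \<le> 0)))"

definition roots_of_height ::
    "'g set \<Rightarrow> ('g \<Rightarrow> 'k) set \<Rightarrow> ('g \<Rightarrow> 'k) \<Rightarrow> int \<Rightarrow> ('g \<Rightarrow> 'k) set" where
  "roots_of_height T B \<alpha> i = {\<gamma> \<in> roots T. height B \<alpha> \<gamma> = i}"

definition graded_part ::
    "'g set \<Rightarrow> ('g \<Rightarrow> 'k) set \<Rightarrow> ('g \<Rightarrow> 'k) \<Rightarrow> int \<Rightarrow> 'g set" where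
  "graded_part T B \<alpha> i =
     span ((if i = 0 then T else {}) \<union> (\<Union>\<gamma>\<in>roots_of_height T B \<alpha> i. root_space T \<gamma>))"

definition abelian_subspace :: "'g set \<Rightarrow> 'g set \<Rightarrow> bool" where
  "abelian_subspace V A \<longleftrightarrow> subspace A \<and> A \<subseteq> V \<and> (\<forall>x\<in>A. \<forall>y\<in>A. bracket x y = 0)"

end

locale simple_lie_algebra = lie_algebra +
  assumes finite_dimensional: "\<exists>X. finite X \<and> span X = UNIV"
    and nonabelian: "\<exists>x y. bracket x y \<noteq> 0"
    and ideal_trivial: "lie_ideal I \<Longrightarrow> I = {0} \<or> I = UNIV"

end

theory Submission
  imports Defs
begin

text \<open>
  Write \<open>V\<close> for the first graded part and \<open>L\<close> for its set of roots. A complement of \<open>A\<close> can be chosen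
  as a sum of root spaces. Order \<open>L\<close> linearly and additively, and let \<open>S\<close> be the set of leading roots
  of the elements of \<open>A\<close>. By elimination, the root spaces for \<open>L - S\<close> span a complement of \<open>A\<close>, and
  \<open>S\<close> consists of half of \<open>L\<close>. Taking leading terms of \<open>[x,y] = 0\<close> shows that root vectors with roots
  in \<open>S\<close> commute. It remains to see that the same then holds for \<open>L - S\<close>.

  This is a counting argument (lemma \<open>half_independent_complement\<close>). Join two roots of \<open>L\<close> when their
  root vectors do not commute, and give the edge from \<open>\<gamma>\<close> to \<open>\<delta>\<close> the weight \<open>interaction \<gamma> \<delta>\<close>, the
  eigenvalue of \<open>ad f\<^sub>\<gamma> ad e\<^sub>\<gamma>\<close> on \<open>e\<^sub>\<delta>\<close>. If these weights are symmetric, positive on edges, and have the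
  same sum \<open>c\<close> at each root, then an independent set with half of the vertices uses up the weight at
  all vertices of its complement, which is therefore independent too.

  Positivity (lemma \<open>interaction_nonneg\<close>) and constancy of the sum (lemma \<open>level_trace_independent\<close>)
  both come from one identity, lemma \<open>sum_weights_bracket\<close>: for \<open>e\<close> of weight \<open>\<delta>\<close>, \<open>f\<close> of weight \<open>-\<delta>\<close>
  and a set \<open>M\<close> of weights, the trace of \<open>ad [e,f]\<close> on the sum of the weight spaces in \<open>M\<close> is the
  difference of the traces of \<open>ad f ad e\<close> for \<open>M - \<delta>\<close> and for \<open>M\<close>. With \<open>M\<close> one end of a root string
  it expresses an interaction as a sum of terms of one sign. With \<open>M\<close> the set of roots of degree \<open>i\<close>
  it says that the trace of \<open>ad f\<^sub>\<gamma> ad e\<^sub>\<gamma>\<close> in degree \<open>i - 1\<close> exceeds that in degree \<open>i\<close> by the trace of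
  \<open>ad h\<^sub>\<gamma>\<close> in degree \<open>i\<close>. The latter is the same for all \<open>\<gamma>\<close> in \<open>L\<close>, since \<open>h\<^sub>\<gamma> - h\<^sub>\<alpha>\<close> is a combination
  of the \<open>h\<^sub>\<beta>\<close> with \<open>\<beta> \<noteq> \<alpha>\<close> simple, which are commutators in degree \<open>0\<close>.

  The same identity yields the structure theory that is needed for a Cartan subalgebra \<open>T\<close> given as a
  nilpotent self-normalising subalgebra. Generalised weight spaces decompose the algebra. Summing over
  a whole string shows that weights are rationally proportional on \<open>[e,f]\<close>, which gives Cartan's
  criterion, so that the Killing form is nondegenerate. Summing over the weights \<open>-n \<nu>\<close> with \<open>n \<ge> 1\<close>
  shows that root spaces are lines.
\<close>

section \<open>Traces and generalised eigenspaces of linear operators\<close>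

text \<open>This locale adds nothing to \<^locale>\<open>finite_dimensional_vector_space\<close>. It keeps the constants
  below apart from the global interpretations of that locale for real vector spaces.\<close>

locale fin_dim_space = finite_dimensional_vector_space scale Basis
  for scale :: "'a::field \<Rightarrow> 'b::ab_group_add \<Rightarrow> 'b" and Basis
begin

abbreviation endo :: "('b \<Rightarrow> 'b) \<Rightarrow> bool" where
  "endo \<equiv> Vector_Spaces.linear scale scale"

abbreviation functional :: "('b \<Rightarrow> 'a) \<Rightarrow> bool" where
  "functional \<equiv> Vector_Spaces.linear scale (*)"

lemma vector_space_mult: "vector_space ((*) :: 'a \<Rightarrow> 'a \<Rightarrow> 'a)"
  by unfold_locales (auto simp: algebra_simps)

lemma endo_iff:
  "endo f \<longleftrightarrow> (\<forall>x y. f (x + y) = f x + f y) \<and> (\<forall>c x. f (scale c x) = scale c (f x))"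
  unfolding Vector_Spaces.linear_iff using vector_space_axioms by blast

lemma functional_iff:
  "functional f \<longleftrightarrow> (\<forall>x y. f (x + y) = f x + f y) \<and> (\<forall>c x. f (scale c x) = c * f x)"
  unfolding Vector_Spaces.linear_iff using vector_space_axioms vector_space_mult by blast

lemma endo_add: "endo f \<Longrightarrow> f (x + y) = f x + f y"
  and endo_scale: "endo f \<Longrightarrow> f (scale c x) = scale c (f x)"
  by (auto simp: endo_iff)

lemma endo_0: "endo f \<Longrightarrow> f 0 = 0"
  using endo_scale[of f 0 0] by simp

lemma endo_diff: "endo f \<Longrightarrow> f (x - y) = f x - f y"
  using endo_add[of f "x - y" y] by simp

lemma endo_sum: "endo f \<Longrightarrow> f (\<Sum>i\<in>I. g i) = (\<Sum>i\<in>I. f (g i))"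
  by (induction I rule: infinite_finite_induct) (auto simp: endo_0 endo_add)

lemma functional_add: "functional f \<Longrightarrow> f (x + y) = f x + f y"
  and functional_scale: "functional f \<Longrightarrow> f (scale c x) = c * f x"
  by (auto simp: functional_iff)

lemma functional_0: "functional f \<Longrightarrow> f 0 = 0"
  by (metis functional_iff mult_zero_left scale_zero_left)

lemma functional_sum: "functional f \<Longrightarrow> f (\<Sum>i\<in>I. g i) = (\<Sum>i\<in>I. f (g i))"
  by (induction I rule: infinite_finite_induct) (auto simp: functional_0 functional_iff)

lemma endo_comp: "endo f \<Longrightarrow> endo g \<Longrightarrow> endo (\<lambda>x. f (g x))"
  by (simp add: endo_iff)

lemma endo_shift: "endo f \<Longrightarrow> endo (\<lambda>x. f x - scale c x)"
  by (simp add: endo_iff algebra_simps scale_left_commute)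

lemma endo_setsum: "(\<And>i. i \<in> I \<Longrightarrow> endo (f i)) \<Longrightarrow> endo (\<lambda>x. \<Sum>i\<in>I. f i x)"
  by (simp add: endo_iff sum.distrib scale_sum_right)

lemma endo_ident: "endo (\<lambda>x. x)"
  by (simp add: endo_iff)

lemma endo_funpow: "endo f \<Longrightarrow> endo (f ^^ n)"
  by (induction n) (auto simp: endo_iff)

lemma subspace_kernel_endo: "endo f \<Longrightarrow> subspace {x. f x = 0}"
  by (auto simp: subspace_def endo_0 endo_add endo_scale)

lemma subspace_image_endo:
  assumes f: "endo f" and V: "subspace V"
  shows "subspace (f ` V)"
proof (rule subspaceI)
  show "0 \<in> f ` V" using endo_0[OF f] subspace_0[OF V] by force
  show "x + y \<in> f ` V" if xy: "x \<in> f ` V" "y \<in> f ` V" for x y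
  proof -
    from xy obtain u v where "x = f u" "y = f v" "u \<in> V" "v \<in> V" by blast
    then have "x + y = f (u + v)" "u + v \<in> V" using endo_add[OF f] subspace_add[OF V] by auto
    then show ?thesis by blast
  qed
  show "scale c x \<in> f ` V" if x: "x \<in> f ` V" for c x
  proof -
    from x obtain u where "x = f u" "u \<in> V" by blast
    then have "scale c x = f (scale c u)" "scale c u \<in> V" using endo_scale[OF f] subspace_scale[OF V] by auto
    then show ?thesis by blast
  qed
qed

lemma endo_eq_on_span: "endo f \<Longrightarrow> (\<And>x. x \<in> X \<Longrightarrow> f x = 0) \<Longrightarrow> x \<in> span X \<Longrightarrow> f x = 0"
  using span_minimal[of X "{x. f x = 0}"] subspace_kernel_endo[of f] by auto

lemma funpow_zero_mono: "endo f \<Longrightarrow> (f ^^ n) x = 0 \<Longrightarrow> n \<le> m \<Longrightarrow> (f ^^ m) x = 0"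
  by (metis endo_0 endo_funpow funpow_add le_add_diff_inverse2 o_apply)

lemma funpow_stable: "(\<And>x. x \<in> V \<Longrightarrow> f x \<in> V) \<Longrightarrow> x \<in> V \<Longrightarrow> (f ^^ n) x \<in> V"
  by (induction n) auto

definition gen_eigenspace :: "('b \<Rightarrow> 'b) \<Rightarrow> 'a \<Rightarrow> 'b set" where
  "gen_eigenspace f c = {x. \<exists>n. ((\<lambda>x. f x - scale c x) ^^ n) x = 0}"

lemma subspace_gen_eigenspace:
  assumes "endo f"
  shows "subspace (gen_eigenspace f c)"
proof (rule subspaceI)
  let ?g = "\<lambda>x. f x - scale c x"
  have g: "endo (?g ^^ n)" for n by (intro endo_funpow endo_shift assms)
  show "0 \<in> gen_eigenspace f c" by (auto simp: gen_eigenspace_def intro: exI[of _ 0])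
  show "x + y \<in> gen_eigenspace f c" if xy: "x \<in> gen_eigenspace f c" "y \<in> gen_eigenspace f c" for x y
  proof -
    from xy obtain m n where "(?g ^^ m) x = 0" "(?g ^^ n) y = 0"
      by (auto simp: gen_eigenspace_def)
    then have "(?g ^^ (m + n)) x = 0" "(?g ^^ (m + n)) y = 0"
      using funpow_zero_mono[OF endo_shift[OF assms]] by auto
    then have "(?g ^^ (m + n)) (x + y) = 0" by (simp add: endo_add[OF g])
    then show ?thesis by (auto simp: gen_eigenspace_def)
  qed
  show "scale d x \<in> gen_eigenspace f c" if "x \<in> gen_eigenspace f c" for d x
    using that by (auto simp: gen_eigenspace_def endo_scale[OF g])
qed

lemma gen_eigenspace_shiftD:
  "f x - scale c x \<in> gen_eigenspace f c \<Longrightarrow> x \<in> gen_eigenspace f c"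
proof -
  assume "f x - scale c x \<in> gen_eigenspace f c"
  then obtain n where "((\<lambda>x. f x - scale c x) ^^ n) (f x - scale c x) = 0"
    by (auto simp: gen_eigenspace_def)
  then have "((\<lambda>x. f x - scale c x) ^^ Suc n) x = 0" by (simp only: funpow_Suc_right o_apply)
  then show ?thesis unfolding gen_eigenspace_def by blast
qed

text \<open>On the generalised eigenspace for \<open>c\<close> the operator \<open>f - d\<close> is invertible, being the sum of
  the nonzero scalar \<open>c - d\<close> and a nilpotent operator.\<close>

lemma gen_eigenspace_shift_surj:
  assumes f: "endo f" and "c \<noteq> d" and V: "subspace V" "\<And>x. x \<in> V \<Longrightarrow> f x \<in> V"
    and x: "x \<in> V" "x \<in> gen_eigenspace f c"
  shows "\<exists>y\<in>V \<inter> gen_eigenspace f c. f y - scale d y = x"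
proof -
  let ?g = "\<lambda>x. f x - scale c x"
  obtain n where "(?g ^^ n) x = 0" using x by (auto simp: gen_eigenspace_def)
  then show ?thesis using x(1)
  proof (induction n arbitrary: x)
    case 0
    then show ?case
      by (intro bexI[of _ 0])
        (auto simp: endo_0[OF f] subspace_0[OF V(1)] subspace_0[OF subspace_gen_eigenspace[OF f]])
  next
    case (Suc n)
    have gV: "?g x \<in> V" using V Suc by (auto intro!: subspace_diff subspace_scale)
    have "(?g ^^ n) (?g x) = 0" using Suc.prems by (simp only: funpow_Suc_right o_apply)
    from Suc.IH[OF this gV] obtain y where
      y: "y \<in> V" "y \<in> gen_eigenspace f c" "f y - scale d y = ?g x" by auto
    \<comment> \<open>\<open>x = ((f - d) x - (f - c) x) / (c - d)\<close>\<close>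
    let ?z = "scale (1 / (c - d)) (x - y)"
    have "x \<in> gen_eigenspace f c" using Suc.prems(1) unfolding gen_eigenspace_def by blast
    then have "?z \<in> V \<inter> gen_eigenspace f c"
      using Suc y V(1) subspace_gen_eigenspace[OF f]
      by (auto intro!: subspace_diff subspace_scale)
    moreover have "f ?z - scale d ?z = scale (1 / (c - d)) (f x - scale d x - (f y - scale d y))"
      by (simp add: endo_scale[OF f] endo_diff[OF f] scale_right_diff_distrib scale_left_commute)
    moreover have "\<dots> = x"
      unfolding y(3) using \<open>c \<noteq> d\<close>
      by (simp add: scale_right_diff_distrib[symmetric] scale_left_diff_distrib[symmetric])
    ultimately show ?case by (intro bexI[of _ ?z]) (simp_all only:)
  qed
qed

lemma gen_eigenspace_disjoint:
  assumes f: "endo f" and "c \<noteq> d" and x: "x \<in> gen_eigenspace f c" "x \<in> gen_eigenspace f d"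
  shows "x = 0"
proof -
  let ?g = "\<lambda>x. f x - scale c x" and ?D = "gen_eigenspace f d"
  have step: "f y \<in> ?D" if "y \<in> ?D" for y
  proof -
    from that obtain n where "((\<lambda>x. f x - scale d x) ^^ n) y = 0"
      by (auto simp: gen_eigenspace_def)
    then have "((\<lambda>x. f x - scale d x) ^^ n) (f y - scale d y) = 0"
      by (metis (no_types, lifting) endo_0 endo_shift f funpow_swap1)
    then have "f y - scale d y \<in> ?D" by (auto simp: gen_eigenspace_def)
    then have "(f y - scale d y) + scale d y \<in> ?D"
      by (intro subspace_add[OF subspace_gen_eigenspace[OF f]]
          subspace_scale[OF subspace_gen_eigenspace[OF f]] that)
    then show ?thesis by simp
  qed
  obtain n where "(?g ^^ n) x = 0" using x by (auto simp: gen_eigenspace_def)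
  then show ?thesis using x(2)
  proof (induction n arbitrary: x)
    case (Suc n)
    have "(?g ^^ n) (?g x) = 0" using Suc.prems by (simp only: funpow_Suc_right o_apply)
    moreover have "?g x \<in> ?D"
      by (intro subspace_diff[OF subspace_gen_eigenspace[OF f]]
          subspace_scale[OF subspace_gen_eigenspace[OF f]] step Suc.prems)
    ultimately have "?g x = 0" by (rule Suc.IH)
    then have 1: "f x = scale c x" by simp
    obtain m where m: "((\<lambda>x. f x - scale d x) ^^ m) x = 0"
      using Suc.prems by (auto simp: gen_eigenspace_def)
    have "((\<lambda>x. f x - scale d x) ^^ k) x = scale ((c - d) ^ k) x" for k
      by (induction k)
        (auto simp: endo_scale[OF f] 1 scale_left_diff_distrib algebra_simps)
    with m show ?case using \<open>c \<noteq> d\<close> by simp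
  qed simp
qed

text \<open>The value of \<open>p(f)\<close> at \<open>v\<close>.\<close>

definition poly_endo :: "'a poly \<Rightarrow> ('b \<Rightarrow> 'b) \<Rightarrow> 'b \<Rightarrow> 'b" where
  "poly_endo p f v = (\<Sum>i\<le>degree p. scale (coeff p i) ((f ^^ i) v))"

lemma poly_endo_bound:
  "degree p \<le> n \<Longrightarrow> poly_endo p f v = (\<Sum>i\<le>n. scale (coeff p i) ((f ^^ i) v))"
  unfolding poly_endo_def
  by (intro sum.mono_neutral_left) (auto simp: coeff_eq_0)

lemma poly_endo_add: "poly_endo (p + q) f v = poly_endo p f v + poly_endo q f v"
proof -
  let ?n = "max (degree p) (degree q)"
  have "degree (p + q) \<le> ?n" by (rule degree_add_le) auto
  then show ?thesis
    by (simp add: poly_endo_bound[of _ ?n] scale_left_distrib sum.distrib)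
qed

lemma poly_endo_smult: "poly_endo (smult c p) f v = scale c (poly_endo p f v)"
  using poly_endo_bound[of "smult c p" "degree p"]
  by (simp add: poly_endo_def scale_sum_right)

lemma poly_endo_shift:
  assumes f: "endo f"
  shows "poly_endo (pCons 0 p) f v = f (poly_endo p f v)"
proof -
  have "poly_endo (pCons 0 p) f v = (\<Sum>i\<le>Suc (degree p). scale (coeff (pCons 0 p) i) ((f ^^ i) v))"
    by (intro poly_endo_bound) (simp add: degree_pCons_le)
  also have "\<dots> = (\<Sum>i\<le>degree p. scale (coeff p i) ((f ^^ Suc i) v))"
    by (subst sum.atMost_Suc_shift) simp
  also have "\<dots> = f (poly_endo p f v)"
    by (simp add: poly_endo_def endo_sum[OF f] endo_scale[OF f])
  finally show ?thesis .
qed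

lemma poly_endo_linear_factor:
  assumes f: "endo f"
  shows "poly_endo ([:- c, 1:] * p) f v = f (poly_endo p f v) - scale c (poly_endo p f v)"
proof -
  have "[:- c, 1:] * p = pCons 0 p + smult (- c) p" by simp
  then show ?thesis by (simp only: poly_endo_add poly_endo_smult poly_endo_shift[OF f]) simp
qed

text \<open>Induction on the number of factors: \<open>w = (f - c) v\<close> is annihilated by one factor less, so it is a
  sum of generalised eigenvectors. Those for eigenvalues other than \<open>c\<close> are in the image of \<open>f - c\<close>;
  after subtracting their preimages from \<open>v\<close> only the eigenvalue \<open>c\<close> is left.\<close>

lemma poly_endo_linear_product:
  assumes f: "endo f" and V: "subspace V" "\<And>x. x \<in> V \<Longrightarrow> f x \<in> V" and v: "v \<in> V"
    and 0: "poly_endo (\<Prod>c\<leftarrow>cs. [:- c, 1:]) f v = 0"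
  shows "v \<in> span (\<Union>c. V \<inter> gen_eigenspace f c)"
  using v 0
proof (induction cs arbitrary: v)
  case Nil
  then show ?case by (simp add: poly_endo_def span_zero)
next
  case (Cons c cs)
  let ?S = "\<lambda>c. V \<inter> gen_eigenspace f c" and ?p = "\<Prod>c\<leftarrow>cs. [:- c, 1:]"
  have sub: "subspace (?S c)" for c
    by (intro subspace_inter V subspace_gen_eigenspace f)
  let ?w = "f v - scale c v"
  have w: "?w \<in> V" using V Cons.prems by (auto intro!: subspace_diff subspace_scale)
  have comm: "poly_endo ?p f ?w = f (poly_endo ?p f v) - scale c (poly_endo ?p f v)"
    by (simp add: poly_endo_def endo_sum[OF f] endo_scale[OF f] scale_sum_right sum_subtractf[symmetric]
        endo_diff[OF endo_funpow[OF f]] endo_scale[OF endo_funpow[OF f]] scale_right_diff_distrib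
        funpow_swap1 mult.commute[of c])
  have "poly_endo ?p f ?w = 0"
    unfolding comm using Cons.prems poly_endo_linear_factor[OF f, of c ?p v] by simp
  then have "?w \<in> span (\<Union>c. ?S c)" by (rule Cons.IH[OF w])
  moreover have "span (\<Union>c. ?S c) \<subseteq> {x. \<exists>u\<in>span (\<Union>c. ?S c). x - (f u - scale c u) \<in> ?S c}"
  proof (rule span_minimal)
    show "(\<Union>c. ?S c) \<subseteq> {x. \<exists>u\<in>span (\<Union>c. ?S c). x - (f u - scale c u) \<in> ?S c}"
    proof clarify
      fix x d assume x: "x \<in> V" "x \<in> gen_eigenspace f d"
      show "\<exists>u\<in>span (\<Union>c. ?S c). x - (f u - scale c u) \<in> ?S c"
      proof (cases "d = c")
        case True
        then show ?thesis using x by (intro bexI[of _ 0]) (auto simp: endo_0[OF f] span_zero)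
      next
        case False
        from gen_eigenspace_shift_surj[OF f this V x] obtain y where
          "y \<in> ?S d" "f y - scale c y = x" by auto
        then show ?thesis
          by (intro bexI[of _ y] span_base) (auto simp: subspace_0[OF V(1)] subspace_0[OF subspace_gen_eigenspace[OF f]])
      qed
    qed
    show "subspace {x. \<exists>u\<in>span (\<Union>c. ?S c). x - (f u - scale c u) \<in> ?S c}"
    proof (rule subspaceI, goal_cases)
      case 1
      show ?case using subspace_0[OF sub[of c]]
        by (auto intro!: bexI[of _ 0] simp: endo_0[OF f] span_zero)
    next
      case (2 x y)
      then obtain u u' where u: "u \<in> span (\<Union>c. ?S c)" "u' \<in> span (\<Union>c. ?S c)"
        "x - (f u - scale c u) \<in> ?S c" "y - (f u' - scale c u') \<in> ?S c" by blast
      have "x + y - (f (u + u') - scale c (u + u')) = (x - (f u - scale c u)) + (y - (f u' - scale c u'))"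
        by (simp add: endo_add[OF f] scale_right_distrib)
      also have "\<dots> \<in> ?S c" by (rule subspace_add[OF sub u(3,4)])
      finally show ?case using span_add[OF u(1,2)] by blast
    next
      case (3 a x)
      then obtain u where u: "u \<in> span (\<Union>c. ?S c)" "x - (f u - scale c u) \<in> ?S c" by blast
      have "scale a x - (f (scale a u) - scale c (scale a u)) = scale a (x - (f u - scale c u))"
        by (simp add: endo_scale[OF f] scale_right_diff_distrib scale_left_commute)
      also have "\<dots> \<in> ?S c" by (rule subspace_scale[OF sub u(2)])
      finally show ?case using span_scale[OF u(1)] by blast
    qed
  qed
  ultimately obtain u where u: "u \<in> span (\<Union>c. ?S c)" "?w - (f u - scale c u) \<in> ?S c" by blast
  have "span (\<Union>c. ?S c) \<subseteq> V" by (rule span_minimal) (use V in auto)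
  with u have "u \<in> V" by auto
  have "f (v - u) - scale c (v - u) = ?w - (f u - scale c u)"
    by (simp add: endo_diff[OF f] scale_right_diff_distrib)
  also have "\<dots> \<in> gen_eigenspace f c" using u by simp
  finally have "v - u \<in> gen_eigenspace f c" by (rule gen_eigenspace_shiftD)
  then have "v - u \<in> ?S c" using Cons.prems \<open>u \<in> V\<close> V(1) by (auto intro: subspace_diff)
  then have "v - u \<in> span (\<Union>c. ?S c)" by (intro span_base) auto
  from span_add[OF this u(1)] show ?case by simp
qed


lemma dim_strict_mono: "subspace U \<Longrightarrow> subspace V \<Longrightarrow> U \<subset> V \<Longrightarrow> dim U < dim V"
  by (rule dim_psubset) (simp only: span_eq_iff[THEN iffD2])

lemma uniformly_nilpotent:
  assumes f: "endo f" and nil: "\<And>x. x \<in> V \<Longrightarrow> \<exists>n. (f ^^ n) x = 0"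
  shows "\<exists>n. \<forall>x\<in>V. (f ^^ n) x = 0"
proof -
  obtain X where X: "X \<subseteq> V" "independent X" "V \<subseteq> span X"
    by (rule basis_exists[of V])
  have fin: "finite X" using X(2) by (rule finiteI_independent)
  from nil X(1) have "\<forall>x\<in>X. \<exists>n. (f ^^ n) x = 0" by (auto simp: subset_iff)
  from bchoice[OF this] obtain n where n: "\<forall>x\<in>X. (f ^^ n x) x = 0" by auto
  have "(f ^^ (Max (n ` X))) x = 0" if "x \<in> X" for x
    by (rule funpow_zero_mono[OF f, of "n x"]) (use fin that n in auto)
  then have "\<forall>x\<in>V. (f ^^ (Max (n ` X))) x = 0"
    using X(3) endo_eq_on_span[OF endo_funpow[OF f], of X] by blast
  then show ?thesis ..
qed

lemma poly_annihilates:
  assumes f: "endo f"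
  shows "\<exists>p. p \<noteq> 0 \<and> poly_endo p f v = 0"
proof (cases "inj_on (\<lambda>i. (f ^^ i) v) {..dimension}")
  case True
  let ?X = "(\<lambda>i. (f ^^ i) v) ` {..dimension}"
  have "card ?X = Suc dimension" using card_image[OF True] by simp
  then have "dependent ?X" using independent_bound_general[of ?X] dim_subset_UNIV[of ?X] by auto
  then obtain u where u: "\<exists>w\<in>?X. u w \<noteq> 0" "(\<Sum>w\<in>?X. scale (u w) w) = 0"
    unfolding dependent_finite[of ?X, simplified] by blast
  let ?p = "\<Sum>i\<le>dimension. monom (u ((f ^^ i) v)) i"
  have c: "coeff ?p i = (if i \<le> dimension then u ((f ^^ i) v) else 0)" for i
    by (simp add: coeff_sum if_distrib sum.delta cong: if_cong)
  have "degree ?p \<le> dimension" by (rule degree_le) (auto simp: c)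
  then have "poly_endo ?p f v = (\<Sum>i\<le>dimension. scale (u ((f ^^ i) v)) ((f ^^ i) v))"
    by (subst poly_endo_bound) (auto simp: c)
  also have "\<dots> = 0" using u(2) by (simp add: sum.reindex[OF True])
  finally have "poly_endo ?p f v = 0" .
  moreover from u(1) obtain i where "i \<le> dimension" "u ((f ^^ i) v) \<noteq> 0" by auto
  then have "coeff ?p i \<noteq> 0" unfolding c by simp
  then have "?p \<noteq> 0" by auto
  ultimately show ?thesis by blast
next
  case False
  then obtain i j where ij: "i \<noteq> j" "(f ^^ i) v = (f ^^ j) v" by (auto simp: inj_on_def)
  let ?p = "monom 1 i - monom 1 j :: 'a poly"
  have c: "coeff ?p k = (if k = i then 1 else 0) - (if k = j then 1 else 0)" for k by simp
  have "degree ?p \<le> max i j" by (rule degree_le) (auto simp: c)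
  then have "poly_endo ?p f v = (\<Sum>k\<le>max i j. scale (coeff ?p k) ((f ^^ k) v))"
    by (rule poly_endo_bound)
  also have "\<dots> = (\<Sum>k\<le>max i j. (if k = i then (f ^^ k) v else 0) - (if k = j then (f ^^ k) v else 0))"
    unfolding c by (intro sum.cong refl) (auto simp: scale_left_diff_distrib)
  also have "\<dots> = 0" using ij by (simp add: sum_subtractf sum.delta)
  finally have "poly_endo ?p f v = 0" .
  moreover have "coeff ?p i \<noteq> 0" unfolding c using ij by simp
  then have "?p \<noteq> 0" by (metis coeff_0)
  ultimately show ?thesis by blast
qed

definition trace :: "('b \<Rightarrow> 'b) \<Rightarrow> 'a" where
  "trace f = (\<Sum>b\<in>Basis. representation Basis (f b) b)"

abbreviation coord :: "'b \<Rightarrow> 'b \<Rightarrow> 'a" where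
  "coord b x \<equiv> representation Basis x b"

lemma functional_coord: "functional (coord b)"
  by (rule linear_representation[OF independent_Basis span_Basis])

lemma coord_expand: "(\<Sum>b\<in>Basis. scale (coord b x) b) = x"
  by (rule sum_representation_eq) (auto simp: independent_Basis span_Basis finite_Basis)

text \<open>Expanding in the basis, both sides become the same double sum over matrix entries.\<close>

lemma trace_comp_commute:
  assumes "endo f" "endo g"
  shows "trace (\<lambda>x. f (g x)) = trace (\<lambda>x. g (f x))"
proof -
  have *: "trace (\<lambda>x. f (g x)) = (\<Sum>b\<in>Basis. \<Sum>c\<in>Basis. coord c (g b) * coord b (f c))"
    if "endo f" "endo g" for f g
    unfolding trace_def
  proof (rule sum.cong[OF refl])
    fix b
    have "f (g b) = (\<Sum>c\<in>Basis. scale (coord c (g b)) (f c))"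
      by (subst coord_expand[of "g b", symmetric]) (simp add: endo_sum endo_scale that)
    then show "coord b (f (g b)) = (\<Sum>c\<in>Basis. coord c (g b) * coord b (f c))"
      by (simp add: functional_sum[OF functional_coord] functional_scale[OF functional_coord])
  qed
  show ?thesis unfolding *[OF assms] *[OF assms(2,1)]
    by (subst sum.swap) (simp add: mult.commute)
qed

lemma trace_add: "trace (\<lambda>x. f x + g x) = trace f + trace g"
  using functional_coord by (simp add: trace_def functional_iff sum.distrib)

lemma trace_scale: "trace (\<lambda>x. scale c (f x)) = c * trace f"
  using functional_coord by (simp add: trace_def functional_iff sum_distrib_left)

lemma trace_zero: "trace (\<lambda>x. 0) = 0"
  using functional_0[OF functional_coord] by (simp add: trace_def)

lemma trace_diff: "trace (\<lambda>x. f x - g x) = trace f - trace g"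
  using trace_add[of "\<lambda>x. f x - g x" g] by simp

lemma trace_sum: "trace (\<lambda>x. \<Sum>i\<in>I. f i x) = (\<Sum>i\<in>I. trace (f i))"
  by (induction I rule: infinite_finite_induct) (auto simp: trace_zero trace_add)

lemma trace_rank_one:
  assumes "functional \<phi>"
  shows "trace (\<lambda>x. scale (\<phi> x) v) = \<phi> v"
proof -
  have "trace (\<lambda>x. scale (\<phi> x) v) = (\<Sum>b\<in>Basis. \<phi> b * coord b v)"
    unfolding trace_def using functional_coord by (simp add: functional_iff)
  also have "\<dots> = \<phi> (\<Sum>b\<in>Basis. scale (coord b v) b)"
    unfolding functional_sum[OF assms] using assms by (simp add: functional_iff mult.commute)
  finally show ?thesis by (simp add: coord_expand)
qed

text \<open>In terms of a basis \<open>C\<close> of its range, \<open>P\<close> is a sum of operators of rank one and trace \<open>1\<close>, one for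
  each element of \<open>C\<close>. This avoids a change of basis of the whole space.\<close>

lemma trace_projection:
  assumes P: "endo P" "\<And>x. P (P x) = P x"
  shows "trace P = of_nat (dim (range P))"
proof -
  obtain C where C: "C \<subseteq> range P" "independent C" "range P \<subseteq> span C" "card C = dim (range P)"
    by (rule basis_exists[of "range P"])
  have fin: "finite C" using C(2) by (rule finiteI_independent)
  have inC: "P x \<in> span C" for x using C(3) by auto
  have coeff_fun: "functional (\<lambda>x. representation C (P x) c)" for c
    unfolding functional_iff
    by (simp add: endo_add[OF P(1)] endo_scale[OF P(1)] representation_add representation_scale C(2) inC)
  have "P = (\<lambda>x. \<Sum>c\<in>C. scale (representation C (P x) c) c)"
    using sum_representation_eq[OF C(2) inC fin] by auto
  then have "trace P = trace (\<lambda>x. \<Sum>c\<in>C. scale (representation C (P x) c) c)" by simp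
  also have "\<dots> = (\<Sum>c\<in>C. representation C (P c) c)"
    by (simp add: trace_sum trace_rank_one[OF coeff_fun])
  also have "\<dots> = (\<Sum>c\<in>C. 1)"
  proof (rule sum.cong[OF refl])
    fix c assume c: "c \<in> C"
    then have "P c = c" using C(1) P(2) by auto
    then show "representation C (P c) c = 1" using representation_basis[OF C(2) c] by simp
  qed
  finally show ?thesis by (simp add: C(4))
qed

text \<open>If \<open>f g f = f\<close>, then \<open>f = f (g f)\<close> and \<open>g f f\<close> have the same trace, while the
  nilpotency order drops when \<open>f\<close> is replaced by \<open>g f f\<close>.\<close>

lemma trace_nilpotent:
  assumes "endo f" "\<And>x. (f ^^ n) x = 0"
  shows "trace f = 0"
  using assms
proof (induction n arbitrary: f)
  case 0
  then have "f = (\<lambda>x. 0)" by auto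
  then show ?case by (simp add: trace_zero)
next
  case (Suc n)
  note f = Suc.prems(1)
  interpret vp: vector_space_pair scale scale ..
  obtain g where g: "endo g" "\<forall>y\<in>f ` UNIV. f (g y) = y"
    using vp.linear_exists_right_inverse_on[OF f, of UNIV] by auto
  have pow: "((\<lambda>x. g (f (f x))) ^^ k) x = (if k = 0 then x else g ((f ^^ Suc k) x))" for k x
  proof (induction k)
    case (Suc k)
    show ?case
    proof (cases "k = 0")
      case False
      then have "((\<lambda>x. g (f (f x))) ^^ Suc k) x = g (f (f (g (f ((f ^^ k) x)))))"
        using Suc by simp
      also have "f (g (f ((f ^^ k) x))) = f ((f ^^ k) x)" using g(2) by auto
      finally show ?thesis by simp
    qed simp
  qed simp
  show ?case
  proof (cases "n = 0")
    case True
    then have "f = (\<lambda>x. 0)" using Suc.prems by auto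
    then show ?thesis by (simp add: trace_zero)
  next
    case False
    have "trace (\<lambda>x. g (f (f x))) = 0"
    proof (rule Suc.IH)
      show "endo (\<lambda>x. g (f (f x)))" by (rule endo_comp[OF g(1) endo_comp[OF f f]])
      show "((\<lambda>x. g (f (f x))) ^^ n) x = 0" for x
        unfolding pow Suc.prems(2) using False by (simp add: endo_0 g(1))
    qed
    moreover have "trace (\<lambda>x. g (f (f x))) = trace (\<lambda>x. f (g (f x)))"
      using trace_comp_commute[OF f endo_comp[OF g(1) f]] by simp
    moreover have "(\<lambda>x. f (g (f x))) = f" using g(2) by auto
    ultimately show ?thesis by simp
  qed
qed

lemma trace_locally_nilpotent:
  assumes "endo f" "\<And>x. \<exists>n. (f ^^ n) x = 0"
  shows "trace f = 0"
  using uniformly_nilpotent[OF assms(1), of UNIV] trace_nilpotent[OF assms(1)] assms(2) by auto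

end

locale alg_closed_space = fin_dim_space scale Basis
  for scale :: "'k::alg_closed_field \<Rightarrow> 'g::ab_group_add \<Rightarrow> 'g" and Basis
begin

text \<open>A polynomial annihilating a given vector splits into linear factors over an algebraically closed
  field, and the factors can be removed one at a time.\<close>

lemma primary_decomposition:
  assumes f: "endo f" and V: "subspace V" "\<And>x. x \<in> V \<Longrightarrow> f x \<in> V"
  shows "V \<subseteq> span (\<Union>c. V \<inter> gen_eigenspace f c)"
proof
  fix v assume v: "v \<in> V"
  obtain p where p: "p \<noteq> 0" "poly_endo p f v = 0" using poly_annihilates[OF f] by blast
  obtain A where A: "p = smult (lead_coeff p) (\<Prod>x\<in>#A. [:- x, 1:])"
    using alg_closed_imp_factorization[OF p(1)] by blast
  obtain cs where cs: "mset cs = A" using ex_mset by blast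
  have "(\<Prod>x\<in>#A. [:- x, 1:]) = (\<Prod>x\<leftarrow>cs. [:- x, 1:])"
    unfolding cs[symmetric] by (metis mset_map prod_mset_prod_list)
  then have "scale (lead_coeff p) (poly_endo (\<Prod>x\<leftarrow>cs. [:- x, 1:]) f v) = 0"
    using p(2) A poly_endo_smult by metis
  then have "poly_endo (\<Prod>x\<leftarrow>cs. [:- x, 1:]) f v = 0" using p(1) by simp
  then show "v \<in> span (\<Union>c. V \<inter> gen_eigenspace f c)"
    using poly_endo_linear_product[OF f V v] by blast
qed

end

section \<open>The weight decomposition for a Cartan subalgebra\<close>

locale cartan_pair = alg_closed_space scale Basis + lie_algebra scale bracket
  for scale :: "'k::{alg_closed_field, field_char_0} \<Rightarrow> 'g::ab_group_add \<Rightarrow> 'g" (infixr "*s" 75)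
    and Basis and bracket :: "'g \<Rightarrow> 'g \<Rightarrow> 'g" +
  fixes T :: "'g set"
  assumes cartan: "cartan_subalgebra T"
begin

lemma endo_bracket: "endo (bracket x)"
  by (simp add: endo_iff bracket_add_right bracket_scale_right)

lemma endo_bracket_left: "endo (\<lambda>y. bracket y x)"
  by (simp add: endo_iff bracket_add_left bracket_scale_left)

lemmas bracket_0_right [simp] = endo_0[OF endo_bracket]
  and bracket_0_left [simp] = endo_0[OF endo_bracket_left]
  and bracket_diff_right = endo_diff[OF endo_bracket]
  and bracket_diff_left = endo_diff[OF endo_bracket_left]
  and bracket_sum_right = endo_sum[OF endo_bracket]
  and bracket_sum_left = endo_sum[OF endo_bracket_left]

lemma bracket_antisym: "bracket x y = - bracket y x"
proof -
  have "bracket (x + y) (x + y) = bracket x x + bracket x y + (bracket y x + bracket y y)"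
    by (simp only: bracket_add_left bracket_add_right ac_simps)
  then show ?thesis by (simp add: bracket_self eq_neg_iff_add_eq_0)
qed

lemma bracket_uminus_right [simp]: "bracket x (- y) = - bracket x y"
  using bracket_diff_right[of x 0 y] by simp

lemma bracket_uminus_left [simp]: "bracket (- x) y = - bracket x y"
  using bracket_diff_left[of 0 x y] by simp

lemma bracket_derivation: "bracket h (bracket x y) = bracket (bracket h x) y + bracket x (bracket h y)"
proof -
  have "bracket x (bracket y h) = - bracket x (bracket h y)"
    by (subst bracket_antisym[of y h]) simp
  moreover have "bracket y (bracket h x) = - bracket (bracket h x) y"
    by (rule bracket_antisym)
  ultimately show ?thesis using jacobi[of h x y] by (simp add: algebra_simps add_eq_0_iff)
qed

lemma bracket_bracket_left: "bracket (bracket x y) z = bracket x (bracket y z) - bracket y (bracket x z)"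
  using bracket_derivation[of x y z] by simp

text \<open>Since \<open>ad h\<close> is a derivation, \<open>(ad h - a - b) [x,y] = [(ad h - a) x, y] + [x, (ad h - b) y]\<close>, and
  each summand has a smaller total order of nilpotency.\<close>

lemma bracket_gen_eigenspace:
  assumes x: "x \<in> gen_eigenspace (bracket h) a" and y: "y \<in> gen_eigenspace (bracket h) b"
  shows "bracket x y \<in> gen_eigenspace (bracket h) (a + b)"
proof -
  let ?D = "\<lambda>c x. bracket h x - c *s x"
  obtain m n where "(?D a ^^ m) x = 0" "(?D b ^^ n) y = 0"
    using x y by (auto simp: gen_eigenspace_def)
  then show ?thesis
  proof (induction "m + n" arbitrary: m n x y)
    case 0
    then show ?case by (auto simp: subspace_0[OF subspace_gen_eigenspace[OF endo_bracket]])
  next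
    case (Suc k)
    note G = subspace_gen_eigenspace[OF endo_bracket]
    have 1: "bracket (?D a x) y \<in> gen_eigenspace (bracket h) (a + b)"
    proof (cases m)
      case 0
      then show ?thesis using Suc.prems by (simp add: subspace_0[OF G])
    next
      case (Suc m')
      then have "(?D a ^^ m') (?D a x) = 0" using Suc.prems by (simp only: funpow_Suc_right o_apply)
      then show ?thesis using Suc.hyps Suc.prems(2) \<open>m = Suc m'\<close> by (intro Suc.hyps(1)[of m' n]) simp_all
    qed
    have 2: "bracket x (?D b y) \<in> gen_eigenspace (bracket h) (a + b)"
    proof (cases n)
      case 0
      then show ?thesis using Suc.prems by (simp add: subspace_0[OF G])
    next
      case (Suc n')
      then have "(?D b ^^ n') (?D b y) = 0" using Suc.prems by (simp only: funpow_Suc_right o_apply)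
      then show ?thesis using Suc.hyps Suc.prems(1) \<open>n = Suc n'\<close> by (intro Suc.hyps(1)[of m n']) simp_all
    qed
    have "?D (a + b) (bracket x y) = bracket (?D a x) y + bracket x (?D b y)"
      by (simp add: bracket_derivation[of h x y] bracket_diff_left bracket_diff_right bracket_scale_left
          bracket_scale_right scale_left_distrib)
    then have "?D (a + b) (bracket x y) \<in> gen_eigenspace (bracket h) (a + b)"
      using subspace_add[OF G 1 2] by simp
    then show ?case by (rule gen_eigenspace_shiftD)
  qed
qed

definition weight_space :: "('g \<Rightarrow> 'k) \<Rightarrow> 'g set" where
  "weight_space \<mu> = {x. \<forall>h\<in>T. x \<in> gen_eigenspace (bracket h) (\<mu> h)}"

lemma subspace_weight_space: "subspace (weight_space \<mu>)"
proof -
  have "weight_space \<mu> = (\<Inter>h\<in>T. gen_eigenspace (bracket h) (\<mu> h))"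
    by (auto simp: weight_space_def)
  then show ?thesis by (simp add: subspace_Int subspace_gen_eigenspace endo_bracket)
qed

lemmas weight_space_0 [simp] = subspace_0[OF subspace_weight_space]
  and weight_space_add = subspace_add[OF subspace_weight_space]
  and weight_space_diff = subspace_diff[OF subspace_weight_space]
  and weight_space_scale = subspace_scale[OF subspace_weight_space]
  and weight_space_sum = subspace_sum[OF subspace_weight_space]

lemma bracket_weight_space:
  "x \<in> weight_space \<mu> \<Longrightarrow> y \<in> weight_space \<nu> \<Longrightarrow> bracket x y \<in> weight_space (\<mu> + \<nu>)"
  by (auto simp: weight_space_def intro: bracket_gen_eigenspace)

lemma subspace_T: "subspace T"
  and bracket_T: "h \<in> T \<Longrightarrow> h' \<in> T \<Longrightarrow> bracket h h' \<in> T"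
  and normalizer_T: "(\<And>h. h \<in> T \<Longrightarrow> bracket x h \<in> T) \<Longrightarrow> x \<in> T"
  and nilpotent_T: "\<exists>n. lower_central T n = {0}"
  using cartan
  by (auto simp: cartan_subalgebra_def nilpotent_subalgebra_def lie_subalgebra_def normalizer_def)

lemma T_subset_weight_space_0: "T \<subseteq> weight_space 0"
proof
  fix x assume x: "x \<in> T"
  obtain n where n: "lower_central T n = {0}" using nilpotent_T by blast
  show "x \<in> weight_space 0"
    unfolding weight_space_def
  proof (clarsimp)
    fix h assume h: "h \<in> T"
    have "((\<lambda>x. bracket h x - 0 *s x) ^^ k) x \<in> lower_central T k" for k
    proof (induction k)
      case (Suc k)
      have "bracket h (((\<lambda>x. bracket h x - 0 *s x) ^^ k) x) \<in> lower_central T (Suc k)"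
        unfolding lower_central.simps by (intro span_base) (use Suc h in blast)
      then show ?case by simp
    qed (use x in simp)
    with n show "x \<in> gen_eigenspace (bracket h) 0"
      unfolding gen_eigenspace_def by blast
  qed
qed

lemma bracket_T_weight_space: "h \<in> T \<Longrightarrow> x \<in> weight_space \<mu> \<Longrightarrow> bracket h x \<in> weight_space \<mu>"
  using bracket_weight_space[of h 0 x \<mu>] T_subset_weight_space_0 by auto

text \<open>Only the values on \<open>T\<close> enter a weight space. Weights are normalised to vanish elsewhere, so that
  distinct weights differ on \<open>T\<close> and the zero weight is the zero function.\<close>

abbreviation vanishes_off_T :: "('g \<Rightarrow> 'k) \<Rightarrow> bool" where
  "vanishes_off_T \<mu> \<equiv> (\<forall>h. h \<notin> T \<longrightarrow> \<mu> h = 0)"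

text \<open>A subspace stable under \<open>T\<close> on which some \<open>ad h\<close> has two generalised eigenvalues is
  spanned by smaller stable subspaces; otherwise it lies in a single weight space.\<close>

lemma stable_subspace_weights:
  assumes "subspace V" "\<And>h x. h \<in> T \<Longrightarrow> x \<in> V \<Longrightarrow> bracket h x \<in> V"
  shows "V \<subseteq> span (\<Union>\<mu>\<in>Collect vanishes_off_T. weight_space \<mu>)"
  using assms
proof (induction "dim V" arbitrary: V rule: less_induct)
  case (less V)
  let ?G = "\<lambda>h c. V \<inter> gen_eigenspace (bracket h) c"
  show ?case
  proof (cases "\<forall>h\<in>T. \<exists>c. V \<subseteq> gen_eigenspace (bracket h) c")
    case True
    from bchoice[OF this] obtain c where c: "\<forall>h\<in>T. V \<subseteq> gen_eigenspace (bracket h) (c h)" by auto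
    let ?\<mu> = "\<lambda>h. if h \<in> T then c h else 0"
    have "V \<subseteq> weight_space ?\<mu>" using c by (auto simp: weight_space_def)
    also have "\<dots> \<subseteq> (\<Union>\<mu>\<in>Collect vanishes_off_T. weight_space \<mu>)" by (rule UN_upper) simp
    finally show ?thesis using span_superset by blast
  next
    case False
    then obtain h where h: "h \<in> T" and split: "\<And>c. \<not> V \<subseteq> gen_eigenspace (bracket h) c" by blast
    have "?G h c \<subseteq> span (\<Union>\<mu>\<in>Collect vanishes_off_T. weight_space \<mu>)" for c
    proof (rule less.hyps)
      show sub: "subspace (?G h c)"
        by (intro subspace_inter less.prems subspace_gen_eigenspace endo_bracket)
      have "?G h c \<subset> V" using split by blast
      then show "dim (?G h c) < dim V" by (rule dim_strict_mono[OF sub less.prems(1)])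
      show "bracket h' x \<in> ?G h c" if "h' \<in> T" "x \<in> ?G h c" for h' x
      proof -
        have "h' \<in> gen_eigenspace (bracket h) 0"
          using that h T_subset_weight_space_0 by (auto simp: weight_space_def)
        from bracket_gen_eigenspace[OF this] that less.prems(2) show ?thesis by fastforce
      qed
    qed
    then have "(\<Union>c. ?G h c) \<subseteq> span (\<Union>\<mu>\<in>Collect vanishes_off_T. weight_space \<mu>)" by blast
    then have "span (\<Union>c. ?G h c) \<subseteq> span (\<Union>\<mu>\<in>Collect vanishes_off_T. weight_space \<mu>)"
      by (intro span_minimal) auto
    moreover have "V \<subseteq> span (\<Union>c. ?G h c)"
      by (rule primary_decomposition[OF endo_bracket]) (use less.prems h in auto)
    ultimately show ?thesis by blast
  qed
qed

text \<open>Given a vanishing sum, a power of \<open>ad h - \<nu>(h)\<close> removes the summand for \<open>\<nu>\<close>; by induction it then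
  kills the others as well, which is impossible for a nonzero summand of weight \<open>\<mu>\<close> with
  \<open>\<mu>(h) \<noteq> \<nu>(h)\<close>.\<close>

lemma weight_vectors_independent:
  assumes "finite F" "\<And>\<mu>. \<mu> \<in> F \<Longrightarrow> vanishes_off_T \<mu>" "\<And>\<mu>. \<mu> \<in> F \<Longrightarrow> x \<mu> \<in> weight_space \<mu>"
    "(\<Sum>\<mu>\<in>F. x \<mu>) = 0" "\<mu> \<in> F"
  shows "x \<mu> = 0"
  using assms
proof (induction F arbitrary: x \<mu> rule: finite_induct)
  case (insert \<nu> F)
  have rest: "x \<mu> = 0" if \<mu>: "\<mu> \<in> F" for \<mu>
  proof -
    have "\<mu> \<noteq> \<nu>" using \<mu> insert.hyps by auto
    then obtain h where "\<mu> h \<noteq> \<nu> h" by auto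
    then have h: "h \<in> T" using insert.prems(1) \<mu> by (metis insertCI)
    let ?D = "\<lambda>x. bracket h x - \<nu> h *s x"
    obtain n where n: "(?D ^^ n) (x \<nu>) = 0"
      using insert.prems(2)[of \<nu>] h by (auto simp: weight_space_def gen_eigenspace_def)
    have D: "endo (?D ^^ n)" by (intro endo_funpow endo_shift endo_bracket)
    have stable: "(?D ^^ n) y \<in> weight_space \<kappa>" if "y \<in> weight_space \<kappa>" for y \<kappa>
      by (rule funpow_stable[OF _ that])
        (auto intro!: weight_space_diff weight_space_scale bracket_T_weight_space h)
    have "(\<Sum>\<mu>\<in>F. (?D ^^ n) (x \<mu>)) = (?D ^^ n) (\<Sum>\<mu>\<in>insert \<nu> F. x \<mu>)"
      using insert.hyps n by (simp add: endo_sum[OF D] endo_add[OF D])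
    also have "\<dots> = 0" using insert.prems(3) by (simp add: endo_0[OF D])
    finally have "(?D ^^ n) (x \<mu>) = 0"
      by (intro insert.IH[of "\<lambda>\<mu>. (?D ^^ n) (x \<mu>)"]) (use insert.prems \<mu> stable in auto)
    then have "x \<mu> \<in> gen_eigenspace (bracket h) (\<nu> h)" by (auto simp: gen_eigenspace_def)
    moreover have "x \<mu> \<in> gen_eigenspace (bracket h) (\<mu> h)"
      using insert.prems(2)[of \<mu>] \<mu> h by (auto simp: weight_space_def)
    ultimately show ?thesis
      using gen_eigenspace_disjoint[OF endo_bracket \<open>\<mu> h \<noteq> \<nu> h\<close>] by blast
  qed
  then have "x \<nu> = 0" using insert by simp
  with rest insert.prems(4) show ?case by blast
qed simp

lemma lower_central_subset: "lower_central T n \<subseteq> T"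
proof (induction n)
  case (Suc n)
  show ?case unfolding lower_central.simps
    by (rule span_minimal) (use Suc bracket_T subspace_T in auto)
qed simp

text \<open>Suppose that \<open>T\<close> is smaller than its weight space \<open>W\<close> for \<open>0\<close>, and let \<open>V\<close> be minimal among
  the stable subspaces with \<open>T \<subset> V \<subseteq> W\<close>. Descending along the lower central series, \<open>[V, C] \<subseteq> T\<close>
  for every term \<open>C\<close>: modulo the next term, \<open>ad c\<close> commutes with \<open>T\<close>, so that \<open>[c, V] + T\<close> is
  stable, and it is not \<open>V\<close> because \<open>ad c\<close> is nilpotent on \<open>V\<close>. So \<open>V\<close> normalises \<open>T\<close>.\<close>

lemma weight_space_zero_functional: "weight_space 0 = T"
proof (rule ccontr)
  assume neq: "weight_space 0 \<noteq> T"
  define P where "P V \<longleftrightarrow> subspace V \<and> T \<subset> V \<and> V \<subseteq> weight_space 0 \<and>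
    (\<forall>h\<in>T. \<forall>x\<in>V. bracket h x \<in> V)" for V
  have "P (weight_space 0)"
    using neq T_subset_weight_space_0 subspace_weight_space bracket_T_weight_space by (auto simp: P_def)
  then obtain V where V: "P V" and min: "\<And>U. P U \<Longrightarrow> dim V \<le> dim U"
    using ex_has_least_nat[of P "weight_space 0" dim] by blast
  obtain n where n: "lower_central T n = {0}" using nilpotent_T by blast
  have "\<forall>c\<in>lower_central T (n - k). \<forall>v\<in>V. bracket c v \<in> T" for k
  proof (induction k)
    case 0
    then show ?case using n by (auto simp: subspace_0 subspace_T)
  next
    case (Suc k)
    show ?case
    proof (cases "n - k = 0")
      case True
      then show ?thesis using Suc by simp
    next
      case False
      then have step: "n - k = Suc (n - Suc k)" by simp
      show ?thesis
      proof
        fix c assume c: "c \<in> lower_central T (n - Suc k)"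
        then have cT: "c \<in> T" using lower_central_subset by blast
        define U where "U = {bracket c v + t | v t. v \<in> V \<and> t \<in> T}"
        have subU: "subspace U"
          unfolding U_def
        proof (rule subspaceI, goal_cases)
          case 1
          show ?case using V subspace_0[of V] subspace_0[OF subspace_T]
            by (intro CollectI exI[of _ 0]) (auto simp: P_def)
        next
          case (2 x y)
          then obtain v t v' t' where *: "x = bracket c v + t" "y = bracket c v' + t'" "v \<in> V" "v' \<in> V" "t \<in> T" "t' \<in> T"
            by blast
          then have "x + y = bracket c (v + v') + (t + t')" by (simp add: bracket_add_right)
          moreover have "v + v' \<in> V" "t + t' \<in> T"
            using * V subspace_T by (auto simp: P_def subspace_add)
          ultimately show ?case by blast
        next
          case (3 a x)
          then obtain v t where *: "x = bracket c v + t" "v \<in> V" "t \<in> T" by blast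
          then have "a *s x = bracket c (a *s v) + (a *s t)" by (simp add: bracket_scale_right scale_right_distrib)
          moreover have "a *s v \<in> V" "a *s t \<in> T"
            using * V subspace_T by (auto simp: P_def subspace_scale)
          ultimately show ?case by blast
        qed
        have TU: "T \<subseteq> U"
        proof
          fix t assume "t \<in> T"
          moreover have "0 \<in> V" using V by (auto simp: P_def subspace_0)
          moreover have "t = bracket c 0 + t" by simp
          ultimately show "t \<in> U" unfolding U_def by blast
        qed
        have UV: "U \<subseteq> V" unfolding U_def using V cT by (auto simp: P_def intro!: subspace_add)
        have stableU: "bracket h x \<in> U" if h: "h \<in> T" and x: "x \<in> U" for h x
        proof -
          from x obtain v t where *: "x = bracket c v + t" "v \<in> V" "t \<in> T" by (auto simp: U_def)
          have "bracket h c \<in> lower_central T (n - k)"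
            unfolding step lower_central.simps by (intro span_base) (use h c in blast)
          then have "bracket (bracket h c) v \<in> T" using Suc * by blast
          then have "bracket (bracket h c) v + bracket h t \<in> T"
            using bracket_T[OF h *(3)] by (intro subspace_add[OF subspace_T])
          moreover have "bracket h x = bracket c (bracket h v) + (bracket (bracket h c) v + bracket h t)"
            using * by (simp add: bracket_add_right bracket_derivation[of h c v])
          moreover have "bracket h v \<in> V" using V h * by (auto simp: P_def)
          ultimately show ?thesis unfolding U_def by blast
        qed
        have "U \<noteq> V"
        proof
          assume "U = V"
          have nil: "\<exists>n. (bracket c ^^ n) x = 0" if "x \<in> V" for x
          proof -
            from that V cT have "x \<in> gen_eigenspace (bracket c) 0"
              by (auto simp: P_def weight_space_def)
            then show ?thesis by (simp add: gen_eigenspace_def)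
          qed
          then obtain m where m: "\<forall>x\<in>V. (bracket c ^^ m) x = 0"
            using uniformly_nilpotent[OF endo_bracket, of V c] by auto
          have "\<exists>v\<in>V. x - (bracket c ^^ j) v \<in> T" if "x \<in> V" for x j
          proof (induction j)
            case 0
            then show ?case using that by (intro bexI[of _ x]) (auto simp: subspace_0 subspace_T)
          next
            case (Suc j)
            then obtain v where v: "v \<in> V" "x - (bracket c ^^ j) v \<in> T" by blast
            then have "v \<in> U" using \<open>U = V\<close> by simp
            then obtain w t where w: "v = bracket c w + t" "w \<in> V" "t \<in> T"
              unfolding U_def by blast
            have "(bracket c ^^ j) t \<in> T" by (rule funpow_stable) (use cT bracket_T w in auto)
            then have "(x - (bracket c ^^ j) v) + (bracket c ^^ j) t \<in> T"
              by (rule subspace_add[OF subspace_T v(2)])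
            also have "(x - (bracket c ^^ j) v) + (bracket c ^^ j) t = x - (bracket c ^^ Suc j) w"
              unfolding w(1) by (simp add: endo_add[OF endo_funpow[OF endo_bracket]] funpow_swap1)
            finally show ?case using w by blast
          qed
          from this[of _ m] m have "V \<subseteq> T" by auto
          then show False using V by (auto simp: P_def)
        qed
        have "U = T"
        proof (rule ccontr)
          assume "U \<noteq> T"
          then have "P U" using subU TU UV stableU V by (auto simp: P_def)
          then have "dim V \<le> dim U" by (rule min)
          moreover have "dim U < dim V"
            using subU V UV \<open>U \<noteq> V\<close> by (intro dim_strict_mono) (auto simp: P_def)
          ultimately show False by simp
        qed
        moreover have "bracket c v \<in> U" if "v \<in> V" for v
        proof -
          have "bracket c v = bracket c v + 0" by simp
          then show ?thesis unfolding U_def using that subspace_0[OF subspace_T] by blast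
        qed
        ultimately show "\<forall>v\<in>V. bracket c v \<in> T" by auto
      qed
    qed
  qed
  from this[of n] have *: "\<forall>h\<in>T. \<forall>v\<in>V. bracket h v \<in> T" by simp
  have "V \<subseteq> T"
  proof
    fix v assume v: "v \<in> V"
    have "bracket v h \<in> T" if "h \<in> T" for h
      unfolding bracket_antisym[of v h] using * that v by (intro subspace_neg[OF subspace_T]) blast
    then show "v \<in> T" by (rule normalizer_T)
  qed
  then show False using V by (auto simp: P_def)
qed

definition weights :: "('g \<Rightarrow> 'k) set" where
  "weights = {\<mu>. vanishes_off_T \<mu> \<and> weight_space \<mu> \<noteq> {0}}"

lemma weights_vanish: "\<mu> \<in> weights \<Longrightarrow> vanishes_off_T \<mu>"
  by (simp add: weights_def)

lemma weight_space_trivial: "vanishes_off_T \<mu> \<Longrightarrow> \<mu> \<notin> weights \<Longrightarrow> weight_space \<mu> = {0}"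
  by (simp add: weights_def)

definition decomposes :: "('g \<Rightarrow> 'k) set \<Rightarrow> 'g \<Rightarrow> (('g \<Rightarrow> 'k) \<Rightarrow> 'g) \<Rightarrow> bool" where
  "decomposes F x c \<longleftrightarrow> (\<forall>\<mu>. c \<mu> \<in> weight_space \<mu>) \<and> (\<forall>\<mu>. \<mu> \<notin> F \<longrightarrow> c \<mu> = 0) \<and> x = (\<Sum>\<mu>\<in>F. c \<mu>)"

lemma decomposes_mono: "decomposes F x c \<Longrightarrow> F \<subseteq> F' \<Longrightarrow> finite F' \<Longrightarrow> decomposes F' x c"
  unfolding decomposes_def by (auto intro: sum.mono_neutral_left)

lemma decomposes_add: "decomposes F x c \<Longrightarrow> decomposes F y d \<Longrightarrow> decomposes F (x + y) (\<lambda>\<mu>. c \<mu> + d \<mu>)"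
  unfolding decomposes_def by (auto simp: sum.distrib weight_space_add)

lemma decomposes_scale: "decomposes F x c \<Longrightarrow> decomposes F (a *s x) (\<lambda>\<mu>. a *s c \<mu>)"
  unfolding decomposes_def by (auto simp: scale_sum_right weight_space_scale)

lemma finite_decomposition:
  "\<exists>F. finite F \<and> F \<subseteq> Collect vanishes_off_T \<and> (\<forall>x. \<exists>c. decomposes F x c)"
proof -
  let ?S = "\<Union>\<mu>\<in>Collect vanishes_off_T. weight_space \<mu>"
  let ?Q = "\<lambda>x F. finite F \<and> F \<subseteq> Collect vanishes_off_T \<and> (\<exists>c. decomposes F x c)"
  have "\<exists>F. ?Q x F" if "x \<in> span ?S" for x
    using that
  proof (induction rule: span_induct_alt)
    case base
    then show ?case by (intro exI[of _ "{}"]) (auto simp: decomposes_def intro!: exI[of _ "\<lambda>_. 0"])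
  next
    case (step a x y)
    then obtain \<mu> where \<mu>: "vanishes_off_T \<mu>" "x \<in> weight_space \<mu>" by blast
    from step obtain F c where F: "finite F" "F \<subseteq> Collect vanishes_off_T" "decomposes F y c" by blast
    have "decomposes {\<mu>} x (\<lambda>\<nu>. if \<nu> = \<mu> then x else 0)" using \<mu> by (auto simp: decomposes_def)
    then have "decomposes (insert \<mu> F) x (\<lambda>\<nu>. if \<nu> = \<mu> then x else 0)"
      by (rule decomposes_mono) (use F in auto)
    moreover have "decomposes (insert \<mu> F) y c" using F by (auto intro: decomposes_mono)
    ultimately have "\<exists>d. decomposes (insert \<mu> F) (a *s x + y) d"
      using decomposes_add decomposes_scale by blast
    then show ?case using F \<mu> by (intro exI[of _ "insert \<mu> F"]) auto
  qed
  moreover have "UNIV \<subseteq> span ?S" by (rule stable_subspace_weights) auto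
  ultimately have "\<forall>x. \<exists>F. ?Q x F" by blast
  then have "\<exists>F. \<forall>x. ?Q x (F x)" by (rule choice)
  then obtain F where F: "\<And>x. ?Q x (F x)" by blast
  let ?F = "\<Union>(F ` Basis)"
  have fin: "finite ?F" using F finite_Basis by auto
  have "\<exists>c. decomposes ?F x c" for x
  proof -
    have "x \<in> span Basis" using span_Basis by simp
    then show ?thesis
    proof (induction rule: span_induct_alt)
      case base
      show ?case by (intro exI[of _ "\<lambda>_. 0"]) (auto simp: decomposes_def)
    next
      case (step a b y)
      from F[of b] obtain c where "decomposes (F b) b c" by blast
      then have "decomposes ?F b c" by (rule decomposes_mono) (use step fin in auto)
      with step show ?case using decomposes_add decomposes_scale by blast
    qed
  qed
  then show ?thesis using fin F by (intro exI[of _ ?F]) blast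
qed

lemma finite_weights: "finite weights"
  and exists_decomposition: "\<exists>c. decomposes weights x c"
proof -
  obtain F where F: "finite F" "F \<subseteq> Collect vanishes_off_T" "\<And>x. \<exists>c. decomposes F x c"
    using finite_decomposition by blast
  have sub: "weights \<subseteq> F"
  proof (rule ccontr)
    assume "\<not> weights \<subseteq> F"
    then obtain \<nu> where \<nu>: "\<nu> \<in> weights" "\<nu> \<notin> F" by blast
    then obtain y where y: "y \<in> weight_space \<nu>" "y \<noteq> 0"
      using weight_space_0 by (auto simp: weights_def)
    obtain c where c: "decomposes F y c" using F by blast
    let ?x = "\<lambda>\<mu>. if \<mu> = \<nu> then y else - c \<mu>"
    have "?x \<nu> = 0"
    proof (rule weight_vectors_independent[of "insert \<nu> F" ?x])
      have "(\<Sum>\<mu>\<in>F. ?x \<mu>) = (\<Sum>\<mu>\<in>F. - c \<mu>)" using \<nu> by (intro sum.cong) auto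
      then show "(\<Sum>\<mu>\<in>insert \<nu> F. ?x \<mu>) = 0"
        using c F(1) \<nu> by (simp add: decomposes_def sum_negf)
      show "?x \<mu> \<in> weight_space \<mu>" for \<mu>
        using c y by (auto simp: decomposes_def subspace_neg[OF subspace_weight_space])
    qed (use F \<nu> in \<open>auto simp: weights_def\<close>)
    then show False using y by simp
  qed
  then show "finite weights" using F(1) by (rule finite_subset)
  obtain c where c: "decomposes F x c" using F by blast
  have "c \<mu> = 0" if "\<mu> \<notin> weights" for \<mu>
    using c that F(2) weight_space_trivial[of \<mu>] by (cases "\<mu> \<in> F") (auto simp: decomposes_def)
  moreover from this have "(\<Sum>\<mu>\<in>F. c \<mu>) = (\<Sum>\<mu>\<in>weights. c \<mu>)"
    using sub F(1) by (intro sum.mono_neutral_right) auto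
  ultimately show "\<exists>c. decomposes weights x c" using c by (auto simp: decomposes_def)
qed

lemma decomposition_unique:
  assumes "decomposes weights x c" "decomposes weights x d"
  shows "c = d"
proof
  fix \<mu>
  show "c \<mu> = d \<mu>"
  proof (cases "\<mu> \<in> weights")
    case True
    have "(\<lambda>\<mu>. c \<mu> - d \<mu>) \<mu> = 0"
      by (rule weight_vectors_independent[OF finite_weights _ _ _ True])
        (use assms in \<open>auto simp: decomposes_def weights_def sum_subtractf weight_space_diff\<close>)
    then show ?thesis by simp
  qed (use assms in \<open>auto simp: decomposes_def\<close>)
qed

definition component :: "'g \<Rightarrow> ('g \<Rightarrow> 'k) \<Rightarrow> 'g" where
  "component x = (THE c. decomposes weights x c)"

lemma component_eqI: "decomposes weights x c \<Longrightarrow> component x = c"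
  unfolding component_def using decomposition_unique by blast

lemma decomposes_component: "decomposes weights x (component x)"
  using exists_decomposition[of x] component_eqI by metis

text \<open>The projection onto the sum of the weight spaces with weights in \<open>M\<close>.\<close>

definition proj :: "('g \<Rightarrow> 'k) set \<Rightarrow> 'g \<Rightarrow> 'g" where
  "proj M x = (\<Sum>\<mu>\<in>M \<inter> weights. component x \<mu>)"

lemma endo_component: "endo (\<lambda>x. component x \<mu>)"
  unfolding endo_iff
  using component_eqI[OF decomposes_add[OF decomposes_component decomposes_component]]
    component_eqI[OF decomposes_scale[OF decomposes_component]] by simp

lemma endo_proj: "endo (proj M)"
  unfolding proj_def[abs_def] by (intro endo_setsum endo_component)

lemma proj_weight_vector_vanishing:
  assumes "vanishes_off_T \<nu>" "x \<in> weight_space \<nu>"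
  shows "proj M x = (if \<nu> \<in> M then x else 0)"
proof (cases "\<nu> \<in> weights")
  case False
  then show ?thesis using assms weight_space_trivial[of \<nu>] by (auto simp: endo_0[OF endo_proj])
next
  case True
  have "decomposes weights x (\<lambda>\<mu>. if \<mu> = \<nu> then x else 0)"
    using assms True finite_weights by (auto simp: decomposes_def sum.delta)
  from component_eqI[OF this] show ?thesis
    using assms True finite_weights by (simp add: proj_def sum.delta)
qed

lemmas proj_weight_vector = proj_weight_vector_vanishing[OF weights_vanish]

lemma proj_sum_singletons: "proj M x = (\<Sum>\<mu>\<in>M \<inter> weights. proj {\<mu>} x)"
  unfolding proj_def by (intro sum.cong) auto

lemma proj_in_weight_space: "proj {\<mu>} x \<in> weight_space \<mu>"
  using decomposes_component[of x] by (cases "\<mu> \<in> weights") (auto simp: proj_def decomposes_def)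

lemma sum_proj: "(\<Sum>\<mu>\<in>weights. proj {\<mu>} x) = x"
  using decomposes_component[of x] by (simp add: proj_def decomposes_def)

lemma endo_eq_weights:
  assumes "endo f" "endo g" "\<And>\<nu> x. \<nu> \<in> weights \<Longrightarrow> x \<in> weight_space \<nu> \<Longrightarrow> f x = g x"
  shows "f x = g x"
  by (subst (1 2) sum_proj[of x, symmetric])
    (simp add: endo_sum assms proj_in_weight_space)

lemma proj_proj: "proj M (proj M' x) = proj (M \<inter> M') x"
  by (rule endo_eq_weights[OF endo_comp[OF endo_proj endo_proj] endo_proj])
    (simp add: proj_weight_vector endo_0[OF endo_proj])

text \<open>Bracketing with a vector of weight \<open>\<delta>\<close> shifts weights by \<open>\<delta>\<close>. The hypothesis only concerns
  weights, because a component whose shift is not a weight is killed.\<close>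

lemma bracket_proj:
  assumes e: "vanishes_off_T \<delta>" "e \<in> weight_space \<delta>"
    and M: "\<And>\<nu>. \<nu> \<in> weights \<Longrightarrow> \<nu> + \<delta> \<in> weights \<Longrightarrow> \<nu> \<in> M \<longleftrightarrow> \<nu> + \<delta> \<in> M'"
  shows "bracket e (proj M x) = proj M' (bracket e x)"
proof (rule endo_eq_weights[OF endo_comp[OF endo_bracket endo_proj] endo_comp[OF endo_proj endo_bracket]])
  fix \<nu> x assume \<nu>: "\<nu> \<in> weights" and x: "x \<in> weight_space \<nu>"
  have ex: "bracket e x \<in> weight_space (\<nu> + \<delta>)"
    using bracket_weight_space[OF e(2) x] by (simp add: add.commute)
  show "bracket e (proj M x) = proj M' (bracket e x)"
  proof (cases "\<nu> + \<delta> \<in> weights")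
    case True
    then show ?thesis using M[OF \<nu> True] by (simp add: proj_weight_vector[OF \<nu> x] proj_weight_vector[OF True ex])
  next
    case False
    then have "bracket e x = 0"
      using weight_space_trivial[OF _ False] ex e(1) \<nu> by (auto simp: weights_def)
    then show ?thesis by (simp add: proj_weight_vector[OF \<nu> x] endo_0[OF endo_proj])
  qed
qed

abbreviation mult :: "('g \<Rightarrow> 'k) \<Rightarrow> nat" where
  "mult \<nu> \<equiv> dim (weight_space \<nu>)"

lemma range_proj_singleton: "\<nu> \<in> weights \<Longrightarrow> range (proj {\<nu>}) = weight_space \<nu>"
proof
  assume \<nu>: "\<nu> \<in> weights"
  show "range (proj {\<nu>}) \<subseteq> weight_space \<nu>" using proj_in_weight_space by blast
  show "weight_space \<nu> \<subseteq> range (proj {\<nu>})"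
  proof
    fix x assume "x \<in> weight_space \<nu>"
    then have "proj {\<nu>} x = x" using proj_weight_vector[OF \<nu>] by simp
    then show "x \<in> range (proj {\<nu>})" by (metis rangeI)
  qed
qed

lemma mult_pos: "\<nu> \<in> weights \<Longrightarrow> mult \<nu> > 0"
  using dim_eq_0[of "weight_space \<nu>"] subspace_weight_space[of \<nu>] weight_space_0[of \<nu>]
  by (auto simp: weights_def)

lemma of_nat_mult_nonzero: "\<nu> \<in> weights \<Longrightarrow> of_nat (mult \<nu>) \<noteq> (0 :: 'k)"
  by (metis mult_pos of_nat_eq_0_iff less_irrefl)

lemma trace_proj: "trace (proj M) = of_nat (dim (range (proj M)))"
  by (rule trace_projection[OF endo_proj]) (simp add: proj_proj)

lemma trace_proj_weight: "\<nu> \<in> weights \<Longrightarrow> trace (proj {\<nu>}) = of_nat (mult \<nu>)"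
  by (simp add: trace_proj range_proj_singleton)

lemma trace_compose_proj:
  assumes "endo f"
  shows "trace (\<lambda>x. f (proj M x)) = (\<Sum>\<nu>\<in>M \<inter> weights. trace (\<lambda>x. f (proj {\<nu>} x)))"
  unfolding trace_sum[symmetric] by (subst proj_sum_singletons) (simp add: endo_sum[OF assms])

lemma proj_UNIV: "proj UNIV x = x"
  using sum_proj[of x] by (subst proj_sum_singletons) simp

lemma trace_weights: "endo f \<Longrightarrow> trace f = (\<Sum>\<nu>\<in>weights. trace (\<lambda>x. f (proj {\<nu>} x)))"
  using trace_compose_proj[of f UNIV] by (simp add: proj_UNIV)

text \<open>On the weight space \<open>ad h - \<nu>(h)\<close> and its square are nilpotent, so they have
  trace \<open>0\<close>.\<close>

lemma
  assumes h: "h \<in> T" and \<nu>: "\<nu> \<in> weights"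
  shows trace_bracket_weight: "trace (\<lambda>x. bracket h (proj {\<nu>} x)) = \<nu> h * of_nat (mult \<nu>)" (is ?A)
    and trace_bracket_bracket_weight:
      "trace (\<lambda>x. bracket h (bracket h (proj {\<nu>} x))) = (\<nu> h)\<^sup>2 * of_nat (mult \<nu>)" (is ?B)
proof -
  let ?D = "\<lambda>x. bracket h x - \<nu> h *s x"
  let ?F = "\<lambda>x. ?D (proj {\<nu>} x)"
  have D: "endo ?D" by (intro endo_shift endo_bracket)
  have F: "endo ?F" by (rule endo_comp[OF D endo_proj])
  have DW: "?D x \<in> weight_space \<nu>" if "x \<in> weight_space \<nu>" for x
    using that by (auto intro!: weight_space_diff weight_space_scale bracket_T_weight_space h)
  have pow: "(?F ^^ Suc n) x = (?D ^^ Suc n) (proj {\<nu>} x)" for n x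
  proof (induction n)
    case (Suc n)
    have "(?D ^^ Suc n) (proj {\<nu>} x) \<in> weight_space \<nu>"
      by (rule funpow_stable[OF DW proj_in_weight_space])
    then have "?F ((?D ^^ Suc n) (proj {\<nu>} x)) = ?D ((?D ^^ Suc n) (proj {\<nu>} x))"
      by (simp only: proj_weight_vector[OF \<nu>] if_True singletonI)
    then show ?case using Suc by (simp only: funpow.simps(2)[of "Suc n"] o_apply)
  qed simp
  have nil: "\<exists>n. (?F ^^ n) x = 0" for x
  proof -
    have "proj {\<nu>} x \<in> gen_eigenspace (bracket h) (\<nu> h)"
      using proj_in_weight_space[of \<nu> x] h by (auto simp: weight_space_def)
    then obtain n where "(?D ^^ n) (proj {\<nu>} x) = 0" by (auto simp: gen_eigenspace_def)
    then have "(?D ^^ Suc n) (proj {\<nu>} x) = 0"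
      by (rule funpow_zero_mono[OF D]) simp
    then have "(?F ^^ Suc n) x = 0" by (simp only: pow)
    then show ?thesis by blast
  qed
  have 0: "trace ?F = 0" by (rule trace_locally_nilpotent[OF F nil])
  then show A: ?A by (simp add: trace_diff trace_scale trace_proj_weight[OF \<nu>])
  have FF: "?F (?F x) = ?D (?D (proj {\<nu>} x))" for x
    by (simp only: proj_weight_vector[OF \<nu> DW[OF proj_in_weight_space]] if_True singletonI)
  have "trace (\<lambda>x. ?F (?F x)) = 0"
  proof (rule trace_locally_nilpotent[OF endo_comp[OF F F]])
    fix x
    obtain n where n: "(?F ^^ n) x = 0" using nil by blast
    have "((\<lambda>x. ?F (?F x)) ^^ k) y = (?F ^^ (2 * k)) y" for k y
    proof (induction k)
      case (Suc k)
      have "2 * Suc k = Suc (Suc (2 * k))" by simp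
      then show ?case by (simp only: funpow.simps o_apply Suc)
    qed (simp only: mult_0_right funpow.simps)
    then have "((\<lambda>x. ?F (?F x)) ^^ n) x = (?F ^^ (2 * n)) x" .
    also have "\<dots> = 0" by (rule funpow_zero_mono[OF F n]) simp
    finally show "\<exists>n. ((\<lambda>x. ?F (?F x)) ^^ n) x = 0" by blast
  qed
  moreover have "bracket h (bracket h (proj {\<nu>} x)) =
      ?F (?F x) + ((2 * \<nu> h) *s bracket h (proj {\<nu>} x) - (\<nu> h)\<^sup>2 *s proj {\<nu>} x)" for x
  proof -
    let ?p = "proj {\<nu>} x"
    have "?D (?D ?p) = bracket h (bracket h ?p) - \<nu> h *s bracket h ?p - (\<nu> h *s bracket h ?p - (\<nu> h)\<^sup>2 *s ?p)"
      by (simp only: bracket_diff_right bracket_scale_right scale_right_diff_distrib power2_eq_square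
          scale_scale)
    moreover have "(2 * \<nu> h) *s bracket h ?p = \<nu> h *s bracket h ?p + \<nu> h *s bracket h ?p"
      by (simp only: mult_2 scale_left_distrib)
    ultimately show ?thesis unfolding FF by (simp only:) (simp add: algebra_simps)
  qed
  ultimately have "trace (\<lambda>x. bracket h (bracket h (proj {\<nu>} x))) =
      2 * \<nu> h * (\<nu> h * of_nat (mult \<nu>)) - (\<nu> h)\<^sup>2 * of_nat (mult \<nu>)"
    by (simp only: trace_add trace_diff trace_scale A trace_proj_weight[OF \<nu>]) simp
  then show ?B by (simp add: power2_eq_square algebra_simps)
qed

end

section \<open>The Killing form and the one-dimensionality of root spaces\<close>

context cartan_pair
begin

lemma weight_space_zero_sum: "x \<in> weight_space \<delta> \<Longrightarrow> y \<in> weight_space (- \<delta>) \<Longrightarrow> bracket x y \<in> T"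
  using bracket_weight_space[of x \<delta> y "- \<delta>"] by (simp add: weight_space_zero_functional)

text \<open>A weight is linear on \<open>T\<close>, being the trace of \<open>ad h\<close> on the weight space divided by the dimension.
  This is where characteristic \<open>0\<close> replaces Lie's theorem.\<close>

lemma
  assumes \<nu>: "\<nu> \<in> weights"
  shows weight_add: "h \<in> T \<Longrightarrow> h' \<in> T \<Longrightarrow> \<nu> (h + h') = \<nu> h + \<nu> h'"
    and weight_scale: "h \<in> T \<Longrightarrow> \<nu> (c *s h) = c * \<nu> h"
proof -
  note m = of_nat_mult_nonzero[OF \<nu>]
  show "\<nu> (h + h') = \<nu> h + \<nu> h'" if h: "h \<in> T" "h' \<in> T"
  proof -
    have "\<nu> (h + h') * of_nat (mult \<nu>) = trace (\<lambda>x. bracket (h + h') (proj {\<nu>} x))"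
      by (rule trace_bracket_weight[OF subspace_add[OF subspace_T h] \<nu>, symmetric])
    also have "\<dots> = (\<nu> h + \<nu> h') * of_nat (mult \<nu>)"
      by (simp add: bracket_add_left trace_add trace_bracket_weight[OF _ \<nu>] h distrib_right)
    finally show ?thesis using m by simp
  qed
  show "\<nu> (c *s h) = c * \<nu> h" if h: "h \<in> T"
  proof -
    have "\<nu> (c *s h) * of_nat (mult \<nu>) = trace (\<lambda>x. bracket (c *s h) (proj {\<nu>} x))"
      by (rule trace_bracket_weight[OF subspace_scale[OF subspace_T h] \<nu>, symmetric])
    also have "\<dots> = (c * \<nu> h) * of_nat (mult \<nu>)"
      by (simp add: bracket_scale_left trace_scale trace_bracket_weight[OF _ \<nu>] h)
    finally show ?thesis using m by simp
  qed
qed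

lemma weight_at_0: "\<nu> \<in> weights \<Longrightarrow> \<nu> 0 = 0"
  using weight_scale[of \<nu> 0 0] subspace_0[OF subspace_T] by simp

lemma weight_dual: "\<nu> \<in> weights \<Longrightarrow> \<nu> \<in> dual_space T"
  by (auto simp: dual_space_def weight_add weight_scale weights_vanish)

text \<open>The operator \<open>ad [e,f]\<close> is a commutator, and \<open>ad f\<close> carries the part \<open>M\<close> to the part \<open>M'\<close>, so
  cyclicity of the trace leaves the difference of the traces of \<open>ad f ad e\<close> on the two parts.\<close>

lemma sum_weights_bracket:
  assumes \<delta>: "vanishes_off_T \<delta>" and e: "e \<in> weight_space \<delta>" and f: "f \<in> weight_space (- \<delta>)"
    and M: "\<And>\<nu>. \<nu> \<in> weights \<Longrightarrow> \<nu> - \<delta> \<in> weights \<Longrightarrow> \<nu> \<in> M \<longleftrightarrow> \<nu> - \<delta> \<in> M'"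
  shows "(\<Sum>\<nu>\<in>M \<inter> weights. \<nu> (bracket e f) * of_nat (mult \<nu>)) =
    trace (\<lambda>x. bracket f (bracket e (proj M' x))) - trace (\<lambda>x. bracket f (bracket e (proj M x)))"
proof -
  have "bracket f (proj M x) = proj M' (bracket f x)" for x
    by (rule bracket_proj[OF _ f]) (use \<delta> M in auto)
  then have *: "bracket (bracket e f) (proj M x) =
      bracket e (proj M' (bracket f x)) - bracket f (bracket e (proj M x))" for x
    by (simp add: bracket_bracket_left)
  have "(\<Sum>\<nu>\<in>M \<inter> weights. \<nu> (bracket e f) * of_nat (mult \<nu>)) =
      (\<Sum>\<nu>\<in>M \<inter> weights. trace (\<lambda>x. bracket (bracket e f) (proj {\<nu>} x)))"
    by (intro sum.cong refl) (simp add: trace_bracket_weight weight_space_zero_sum[OF e f])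
  also have "\<dots> = trace (\<lambda>x. bracket (bracket e f) (proj M x))"
    by (rule trace_compose_proj[OF endo_bracket, symmetric])
  also have "\<dots> = trace (\<lambda>x. bracket e (proj M' (bracket f x))) - trace (\<lambda>x. bracket f (bracket e (proj M x)))"
    unfolding * by (rule trace_diff)
  also have "trace (\<lambda>x. bracket e (proj M' (bracket f x))) = trace (\<lambda>x. bracket f (bracket e (proj M' x)))"
    by (rule trace_comp_commute[OF endo_comp[OF endo_bracket endo_proj] endo_bracket])
  finally show ?thesis .
qed

text \<open>The case \<open>\<delta> = 0\<close>, in which nothing is shifted.\<close>

lemma weight_commutator: 
  assumes "\<nu> \<in> weights" "h \<in> T" "h' \<in> T"
  shows "\<nu> (bracket h h') = 0"
proof -
  have "(\<Sum>\<nu>'\<in>{\<nu>} \<inter> weights. \<nu>' (bracket h h') * of_nat (mult \<nu>')) = 0"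
    by (subst sum_weights_bracket[of 0 _ _ _ "{\<nu>}"]) (use assms in \<open>auto simp: weight_space_zero_functional\<close>)
  then show ?thesis using assms(1) of_nat_mult_nonzero[of \<nu>] by simp
qed

text \<open>Sum over the \<open>\<delta>\<close>-string through \<open>\<mu>\<close>. The shift by \<open>\<delta>\<close> preserves it, so the two traces cancel and a
  linear relation with integer coefficients between \<open>\<mu>\<close> and \<open>\<delta>\<close> on \<open>[e,f]\<close> is left.\<close>

lemma string_rational:
  assumes \<mu>: "\<mu> \<in> weights" and \<delta>: "vanishes_off_T \<delta>"
  shows "\<exists>r. \<forall>e\<in>weight_space \<delta>. \<forall>f\<in>weight_space (- \<delta>). \<mu> (bracket e f) = of_rat r * \<delta> (bracket e f)"
proof -
  let ?M = "{\<nu>. \<exists>n::int. \<nu> = (\<lambda>h. \<mu> h + of_int n * \<delta> h)}"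
  have "\<forall>\<nu>\<in>?M. \<exists>n::int. \<nu> = (\<lambda>h. \<mu> h + of_int n * \<delta> h)" by blast
  from bchoice[OF this] obtain n :: "_ \<Rightarrow> int" where
    n: "\<And>\<nu>. \<nu> \<in> ?M \<Longrightarrow> \<nu> = (\<lambda>h. \<mu> h + of_int (n \<nu>) * \<delta> h)" by blast
  define a where "a = (\<Sum>\<nu>\<in>?M \<inter> weights. mult \<nu>)"
  define b where "b = (\<Sum>\<nu>\<in>?M \<inter> weights. n \<nu> * int (mult \<nu>))"
  have "\<mu> \<in> ?M" by (auto intro!: exI[of _ 0])
  then have pos: "a > 0" unfolding a_def using \<mu> mult_pos[OF \<mu>] finite_weights by (intro sum_pos2[of _ \<mu>]) auto
  have "\<mu> (bracket e f) = of_rat (- (of_int b / of_nat a)) * \<delta> (bracket e f)"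
    if e: "e \<in> weight_space \<delta>" and f: "f \<in> weight_space (- \<delta>)" for e f
  proof -
    let ?h = "bracket e f"
    have "\<nu> \<in> ?M \<longleftrightarrow> \<nu> - \<delta> \<in> ?M" for \<nu>
    proof
      assume "\<nu> \<in> ?M"
      then obtain k :: int where "\<nu> = (\<lambda>h. \<mu> h + of_int k * \<delta> h)" by blast
      then have "\<nu> - \<delta> = (\<lambda>h. \<mu> h + of_int (k - 1) * \<delta> h)" by (auto simp: algebra_simps)
      then show "\<nu> - \<delta> \<in> ?M" by blast
    next
      assume "\<nu> - \<delta> \<in> ?M"
      then obtain k :: int where k: "\<nu> - \<delta> = (\<lambda>h. \<mu> h + of_int k * \<delta> h)" by blast
      have "\<nu> h = \<mu> h + of_int (k + 1) * \<delta> h" for h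
        using fun_cong[OF k, of h] by (simp add: algebra_simps)
      then show "\<nu> \<in> ?M" by blast
    qed
    from sum_weights_bracket[OF \<delta> e f this]
    have "0 = (\<Sum>\<nu>\<in>?M \<inter> weights. \<nu> ?h * of_nat (mult \<nu>))" by simp
    also have "\<dots> = (\<Sum>\<nu>\<in>?M \<inter> weights. \<mu> ?h * of_nat (mult \<nu>) + \<delta> ?h * of_int (n \<nu> * int (mult \<nu>)))"
    proof (rule sum.cong[OF refl])
      fix \<nu> assume "\<nu> \<in> ?M \<inter> weights"
      then have "\<nu> = (\<lambda>h. \<mu> h + of_int (n \<nu>) * \<delta> h)" using n by blast
      then have "\<nu> ?h = \<mu> ?h + of_int (n \<nu>) * \<delta> ?h" by (rule fun_cong)
      then show "\<nu> ?h * of_nat (mult \<nu>) = \<mu> ?h * of_nat (mult \<nu>) + \<delta> ?h * of_int (n \<nu> * int (mult \<nu>))"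
        by (simp add: algebra_simps)
    qed
    also have "\<dots> = \<mu> ?h * of_nat a + \<delta> ?h * of_int b"
      by (simp only: a_def b_def sum.distrib sum_distrib_left[symmetric] of_nat_sum of_int_sum)
    finally have "\<mu> ?h * of_nat a = - of_int b * \<delta> ?h" by (simp add: eq_neg_iff_add_eq_0 add.commute mult.commute)
    then have "\<mu> ?h = - of_int b / of_nat a * \<delta> ?h" using pos by (simp add: field_simps)
    then show ?thesis by (simp only: of_rat_minus of_rat_divide of_rat_of_int_eq of_rat_of_nat_eq) simp
  qed
  then show ?thesis by blast
qed

definition killing :: "'g \<Rightarrow> 'g \<Rightarrow> 'k" where
  "killing x y = trace (\<lambda>z. bracket x (bracket y z))"

lemma killing_sym: "killing x y = killing y x"
  unfolding killing_def by (rule trace_comp_commute[OF endo_bracket endo_bracket])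

lemma functional_killing: "functional (killing x)"
  unfolding functional_iff killing_def
  by (simp add: bracket_add_left bracket_add_right bracket_scale_left bracket_scale_right trace_add trace_scale)

lemmas killing_add_right = functional_add[OF functional_killing]
  and killing_scale_right = functional_scale[OF functional_killing]
  and killing_sum_right = functional_sum[OF functional_killing]
  and killing_0_right = functional_0[OF functional_killing]

lemma killing_add_left: "killing (x + y) z = killing x z + killing y z"
  by (simp add: killing_sym[of _ z] killing_add_right)

lemma killing_scale_left: "killing (c *s x) z = c * killing x z"
  by (simp add: killing_sym[of _ z] killing_scale_right)

lemma killing_diff_right: "killing x (y - z) = killing x y - killing x z"
  using killing_add_right[of x "y - z" z] by simp

lemma killing_minus_right: "killing x (- y) = - killing x y"
  using killing_diff_right[of x 0 y] by (simp add: killing_0_right)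

lemma killing_invariant: "killing (bracket x y) z = killing x (bracket y z)"
proof -
  have "trace (\<lambda>w. bracket y (bracket x (bracket z w))) = trace (\<lambda>w. bracket x (bracket z (bracket y w)))"
    by (rule trace_comp_commute[OF endo_bracket endo_comp[OF endo_bracket endo_bracket]])
  then show ?thesis
    unfolding killing_def by (simp add: bracket_bracket_left bracket_diff_right trace_diff)
qed

text \<open>The operator \<open>ad x ad y\<close> shifts every weight by \<open>\<kappa> + \<mu> \<noteq> 0\<close>, so it has no diagonal part.\<close>

lemma killing_orthogonal:
  assumes x: "vanishes_off_T \<kappa>" "x \<in> weight_space \<kappa>" and y: "vanishes_off_T \<mu>" "y \<in> weight_space \<mu>"
    and neq: "\<kappa> + \<mu> \<noteq> 0"
  shows "killing x y = 0"
proof -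
  let ?f = "\<lambda>z. bracket x (bracket y z)"
  have f: "endo ?f" by (rule endo_comp[OF endo_bracket endo_bracket])
  have "trace (\<lambda>z. ?f (proj {\<nu>} z)) = 0" for \<nu>
  proof -
    let ?\<nu> = "(\<nu> + \<mu>) + \<kappa>"
    have "bracket y (proj {\<nu>} z) = proj {\<nu> + \<mu>} (bracket y z)" for z
      by (rule bracket_proj[OF y]) auto
    moreover have "bracket x (proj {\<nu> + \<mu>} z) = proj {?\<nu>} (bracket x z)" for z
      by (rule bracket_proj[OF x]) auto
    ultimately have shift: "?f (proj {\<nu>} z) = proj {?\<nu>} (?f z)" for z by simp
    have "?\<nu> \<noteq> \<nu>" using neq by (simp add: add.assoc add.commute[of \<mu>])
    then have empty: "{\<nu>} \<inter> {?\<nu>} = {}" by auto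
    have "trace (\<lambda>z. ?f (proj {\<nu>} z)) = trace (\<lambda>z. proj {?\<nu>} (?f (proj {\<nu>} z)))"
      by (simp add: shift[symmetric] proj_proj)
    also have "\<dots> = trace (\<lambda>z. ?f (proj {\<nu>} (proj {?\<nu>} z)))"
      by (rule trace_comp_commute[OF endo_proj endo_comp[OF f endo_proj]])
    also have "\<dots> = 0"
      unfolding proj_proj empty by (simp add: proj_def trace_zero)
    finally show ?thesis .
  qed
  then show ?thesis unfolding killing_def trace_weights[OF f] by simp
qed

lemma killing_proj:
  assumes x: "vanishes_off_T \<kappa>" "x \<in> weight_space \<kappa>"
  shows "killing x (proj {- \<kappa>} y) = killing x y"
proof -
  have "killing x y = (\<Sum>\<nu>\<in>weights. killing x (proj {\<nu>} y))"
    by (subst sum_proj[of y, symmetric]) (rule killing_sum_right)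
  also have "\<dots> = (\<Sum>\<nu>\<in>{- \<kappa>} \<inter> weights. killing x (proj {\<nu>} y))"
  proof (rule sum.mono_neutral_right)
    show "\<forall>\<nu>\<in>weights - {- \<kappa>} \<inter> weights. killing x (proj {\<nu>} y) = 0"
    proof
      fix \<nu> assume \<nu>: "\<nu> \<in> weights - {- \<kappa>} \<inter> weights"
      then have "\<kappa> + \<nu> \<noteq> 0" by (auto simp: add_eq_0_iff)
      then show "killing x (proj {\<nu>} y) = 0"
        by (intro killing_orthogonal[OF x _ proj_in_weight_space]) (use \<nu> in \<open>auto simp: weights_def\<close>)
    qed
  qed (auto simp: finite_weights)
  also have "\<dots> = killing x (\<Sum>\<nu>\<in>{- \<kappa>} \<inter> weights. proj {\<nu>} y)"
    by (rule killing_sum_right[symmetric])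
  also have "(\<Sum>\<nu>\<in>{- \<kappa>} \<inter> weights. proj {\<nu>} y) = proj {- \<kappa>} y"
    by (rule proj_sum_singletons[symmetric])
  finally show ?thesis by simp
qed

lemma killing_T_self: "h \<in> T \<Longrightarrow> killing h h = (\<Sum>\<nu>\<in>weights. (\<nu> h)\<^sup>2 * of_nat (mult \<nu>))"
  unfolding killing_def trace_weights[OF endo_comp[OF endo_bracket endo_bracket]]
  by (intro sum.cong refl) (simp add: trace_bracket_bracket_weight)

text \<open>Polarisation of the previous formula.\<close>

lemma killing_T:
  assumes h: "h \<in> T" "h' \<in> T"
  shows "killing h h' = (\<Sum>\<nu>\<in>weights. \<nu> h * \<nu> h' * of_nat (mult \<nu>))"
proof -
  have "killing (h + h') (h + h') = killing h h + killing h' h' + 2 * killing h h'"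
    by (simp add: killing_add_left killing_add_right killing_sym[of h' h])
  moreover have "killing (h + h') (h + h') = (\<Sum>\<nu>\<in>weights. (\<nu> h)\<^sup>2 * of_nat (mult \<nu>)) +
      (\<Sum>\<nu>\<in>weights. (\<nu> h')\<^sup>2 * of_nat (mult \<nu>)) + 2 * (\<Sum>\<nu>\<in>weights. \<nu> h * \<nu> h' * of_nat (mult \<nu>))"
    unfolding killing_T_self[OF subspace_add[OF subspace_T h]] sum_distrib_left sum.distrib[symmetric]
    by (intro sum.cong refl) (simp add: weight_add h power2_eq_square algebra_simps)
  ultimately show ?thesis using killing_T_self h by simp
qed

end

locale simple_cartan_pair = cartan_pair scale Basis bracket T + simple_lie_algebra scale bracket
  for scale :: "'k::{alg_closed_field, field_char_0} \<Rightarrow> 'g::ab_group_add \<Rightarrow> 'g" (infixr "*s" 75)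
    and Basis and bracket :: "'g \<Rightarrow> 'g \<Rightarrow> 'g" and T
begin

lemma perfect: "span {bracket x y | x y. True} = UNIV"
proof -
  let ?I = "span {bracket x y | x y. True}"
  have "bracket x y \<in> ?I" for x y by (rule span_base) blast
  then have "lie_ideal ?I" by (simp add: lie_ideal_def)
  then have "?I = {0} \<or> ?I = UNIV" by (rule ideal_trivial)
  moreover have "?I \<noteq> {0}" using nonabelian \<open>\<And>y x. bracket x y \<in> ?I\<close> by auto
  ultimately show ?thesis by blast
qed

lemma T_neq_UNIV: "T \<noteq> UNIV"
proof
  assume T: "T = UNIV"
  have "lower_central T n = UNIV" for n
    by (induction n) (use perfect T in auto)
  then show False using nilpotent_T nonabelian by (metis UNIV_I singletonD)
qed

text \<open>If \<open>\<nu> = r\<^sub>\<nu> \<delta>\<close> on \<open>h = [e,f]\<close>, then \<open>killing h h = \<delta>(h)\<^sup>2 \<Sum> r\<^sub>\<nu>\<^sup>2 mult \<nu>\<close>. The sum is a positive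
  rational number, because \<open>\<delta>\<close> itself contributes \<open>mult \<delta>\<close> to it.\<close>

lemma weights_vanish_on_isotropic:
  assumes \<delta>: "vanishes_off_T \<delta>" and e: "e \<in> weight_space \<delta>" and f: "f \<in> weight_space (- \<delta>)"
    and iso: "\<delta> (bracket e f) = 0 \<or> killing (bracket e f) (bracket e f) = 0" and \<mu>: "\<mu> \<in> weights"
  shows "\<mu> (bracket e f) = 0"
proof (cases "\<delta> \<in> weights")
  case False
  then have "e = 0" using weight_space_trivial[OF \<delta>] e by simp
  then show ?thesis using weight_at_0[OF \<mu>] by simp
next
  case True
  let ?h = "bracket e f"
  have "\<forall>\<nu>\<in>weights. \<exists>r. \<nu> ?h = of_rat r * \<delta> ?h"
    using string_rational[OF _ \<delta>] e f by blast
  from bchoice[OF this] obtain r where r: "\<And>\<nu>. \<nu> \<in> weights \<Longrightarrow> \<nu> ?h = of_rat (r \<nu>) * \<delta> ?h" by blast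
  have "\<delta> ?h = 0"
  proof (rule ccontr)
    assume nz: "\<delta> ?h \<noteq> 0"
    then have "killing ?h ?h = 0" using iso by simp
    moreover have "killing ?h ?h = (\<delta> ?h)\<^sup>2 * of_rat (\<Sum>\<nu>\<in>weights. (r \<nu>)\<^sup>2 * of_nat (mult \<nu>))"
      unfolding killing_T_self[OF weight_space_zero_sum[OF e f]] of_rat_sum sum_distrib_left
      by (intro sum.cong refl) (simp add: r of_rat_mult of_rat_power power_mult_distrib mult_ac)
    ultimately have "(\<Sum>\<nu>\<in>weights. (r \<nu>)\<^sup>2 * of_nat (mult \<nu>)) = 0" using nz by simp
    then have "\<forall>\<nu>\<in>weights. (r \<nu>)\<^sup>2 * of_nat (mult \<nu>) = 0"
      by (subst (asm) sum_nonneg_eq_0_iff) (auto simp: finite_weights)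
    then have "r \<delta> = 0" using True weights_def by auto
    then show False using r[OF True] nz by simp
  qed
  then show ?thesis using r[OF \<mu>] by simp
qed

text \<open>Cartan's criterion. If the Killing form were zero, all weights would vanish on the brackets of
  opposite weight vectors, which span \<open>T\<close> because \<open>g = [g,g]\<close>. So \<open>0\<close> would be the only weight and
  \<open>g = T\<close> nilpotent.\<close>

lemma killing_nonzero: "\<exists>x y. killing x y \<noteq> 0"
proof (rule ccontr)
  assume "\<nexists>x y. killing x y \<noteq> 0"
  then have K0: "killing x y = 0" for x y by simp
  have zero: "\<mu> = 0" if \<mu>: "\<mu> \<in> weights" for \<mu>
  proof -
    let ?\<phi> = "\<lambda>x. \<mu> (proj {0} x)"
    have inT: "proj {0} x \<in> T" for x
      using proj_in_weight_space[of 0 x] by (simp add: weight_space_zero_functional)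
    have \<phi>: "functional ?\<phi>"
      unfolding functional_iff
      by (simp add: endo_add[OF endo_proj] endo_scale[OF endo_proj] weight_add[OF \<mu>] weight_scale[OF \<mu>] inT)
    have vec: "?\<phi> (bracket x y) = 0"
      if "\<nu> \<in> weights" "\<kappa> \<in> weights" "x \<in> weight_space \<nu>" "y \<in> weight_space \<kappa>" for \<nu> \<kappa> x y
    proof -
      have xy: "bracket x y \<in> weight_space (\<nu> + \<kappa>)" by (rule bracket_weight_space[OF that(3,4)])
      have off: "vanishes_off_T (\<nu> + \<kappa>)" using that by (simp add: weights_vanish)
      show ?thesis
      proof (cases "\<nu> + \<kappa> = 0")
        case True
        then have "\<kappa> = - \<nu>" by (simp add: add_eq_0_iff)
        then have "\<mu> (bracket x y) = 0"
          using that by (intro weights_vanish_on_isotropic[OF weights_vanish[OF that(1)] that(3) _ _ \<mu>]) (auto simp: K0)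
        then show ?thesis using proj_weight_vector_vanishing[OF off xy] True by simp
      next
        case False
        then show ?thesis using proj_weight_vector_vanishing[OF off xy] weight_at_0[OF \<mu>] by simp
      qed
    qed
    have "?\<phi> (bracket x y) = 0" for x y
    proof -
      have "bracket x y = bracket (\<Sum>\<nu>\<in>weights. proj {\<nu>} x) (\<Sum>\<kappa>\<in>weights. proj {\<kappa>} y)"
        by (simp only: sum_proj)
      also have "\<dots> = (\<Sum>\<nu>\<in>weights. \<Sum>\<kappa>\<in>weights. bracket (proj {\<nu>} x) (proj {\<kappa>} y))"
        by (subst bracket_sum_left) (simp only: bracket_sum_right)
      finally show ?thesis
        by (simp only: functional_sum[OF \<phi>]) (simp add: vec proj_in_weight_space)
    qed
    then have "{bracket x y | x y. True} \<subseteq> {x. ?\<phi> x = 0}" by blast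
    moreover have "subspace {x. ?\<phi> x = 0}"
      by (auto simp: subspace_def functional_add[OF \<phi>] functional_scale[OF \<phi>] functional_0[OF \<phi>])
    ultimately have \<phi>0: "?\<phi> x = 0" for x using span_minimal perfect by blast
    show "\<mu> = 0"
    proof
      fix h
      show "\<mu> h = 0 h"
      proof (cases "h \<in> T")
        case True
        then have "proj {0} h = h"
          by (subst proj_weight_vector_vanishing[of 0]) (auto simp: weight_space_zero_functional)
        then show ?thesis using \<phi>0[of h] by simp
      qed (use \<mu> in \<open>simp add: weights_vanish\<close>)
    qed
  qed
  have "x \<in> weight_space 0" for x
    by (subst sum_proj[symmetric], rule weight_space_sum) (metis zero proj_in_weight_space)
  then show False using T_neq_UNIV weight_space_zero_functional by blast
qed

text \<open>The radical of the Killing form is an ideal, and by Cartan's criterion not everything.\<close>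

lemma killing_nondegenerate:
  assumes "\<And>y. killing x y = 0"
  shows "x = 0"
proof -
  let ?R = "{x. \<forall>y. killing x y = 0}"
  have "lie_ideal ?R"
    unfolding lie_ideal_def
  proof
    show "subspace ?R"
      by (auto simp: subspace_def killing_add_left killing_scale_left killing_sym[of 0] killing_0_right)
    show "\<forall>x. \<forall>y\<in>?R. bracket x y \<in> ?R"
    proof (clarsimp)
      fix x y z assume "\<forall>z. killing y z = 0"
      then have "killing (bracket y x) z = 0" by (simp add: killing_invariant)
      then show "killing (bracket x y) z = 0"
        using killing_minus_right[of z "bracket y x"] by (simp add: bracket_antisym[of x y] killing_sym[of _ z])
    qed
  qed
  then have "?R = {0} \<or> ?R = UNIV" by (rule ideal_trivial)
  then show ?thesis using killing_nonzero assms by auto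
qed

lemma killing_nondegenerate_T:
  assumes h: "h \<in> T" and 0: "\<And>h'. h' \<in> T \<Longrightarrow> killing h h' = 0"
  shows "h = 0"
proof (rule killing_nondegenerate)
  fix y
  have "killing h (proj {- 0} y) = killing h y"
    by (rule killing_proj) (use h in \<open>auto simp: weight_space_zero_functional\<close>)
  moreover have "proj {- 0} y \<in> T"
    using proj_in_weight_space[of "- 0" y] by (simp add: weight_space_zero_functional)
  ultimately show "killing h y = 0" using 0 by metis
qed

lemma weights_separate_T: "h \<in> T \<Longrightarrow> (\<And>\<nu>. \<nu> \<in> weights \<Longrightarrow> \<nu> h = 0) \<Longrightarrow> h = 0"
  by (rule killing_nondegenerate_T) (auto simp: killing_T intro!: sum.neutral)

lemma T_abelian: "h \<in> T \<Longrightarrow> h' \<in> T \<Longrightarrow> bracket h h' = 0"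
  by (rule weights_separate_T) (simp_all add: bracket_T weight_commutator)

lemma weight_pairing:
  assumes "vanishes_off_T \<kappa>" "x \<in> weight_space \<kappa>" "x \<noteq> 0"
  shows "\<exists>y\<in>weight_space (- \<kappa>). killing x y = 1"
proof -
  obtain y where y: "killing x y \<noteq> 0" using killing_nondegenerate assms(3) by blast
  then have "killing x ((1 / killing x y) *s proj {- \<kappa>} y) = 1"
    by (simp add: killing_scale_right killing_proj[OF assms(1,2)])
  then show ?thesis using weight_space_scale[OF proj_in_weight_space] by blast
qed

lemma uminus_weight: 
  assumes "\<nu> \<in> weights"
  shows "- \<nu> \<in> weights"
proof -
  obtain x where "x \<in> weight_space \<nu>" "x \<noteq> 0"
    using assms weight_space_0 by (auto simp: weights_def)
  then obtain y where "y \<in> weight_space (- \<nu>)" "killing x y = 1"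
    using weight_pairing[OF weights_vanish[OF assms]] by blast
  then show ?thesis using assms killing_0_right[of x] by (auto simp: weights_def)
qed

text \<open>In a minimal nonzero stable subspace \<open>V\<close> of a weight space the operators \<open>ad h - \<nu>(h)\<close>
  vanish, since their images are smaller stable subspaces: \<open>T\<close> is abelian and the operators are
  nilpotent.\<close>

lemma exists_eigenvector:
  assumes \<nu>: "\<nu> \<in> weights"
  shows "\<exists>e\<in>weight_space \<nu>. e \<noteq> 0 \<and> (\<forall>h\<in>T. bracket h e = \<nu> h *s e)"
proof -
  define P where "P V \<longleftrightarrow> subspace V \<and> V \<noteq> {0} \<and> V \<subseteq> weight_space \<nu> \<and>
    (\<forall>h\<in>T. \<forall>x\<in>V. bracket h x \<in> V)" for V
  have "P (weight_space \<nu>)"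
    using \<nu> subspace_weight_space bracket_T_weight_space by (auto simp: P_def weights_def)
  then obtain V where V: "P V" and min: "\<And>U. P U \<Longrightarrow> dim V \<le> dim U"
    using ex_has_least_nat[of P "weight_space \<nu>" dim] by blast
  have eig: "bracket h v = \<nu> h *s v" if h: "h \<in> T" and v: "v \<in> V" for h v
  proof -
    let ?D = "\<lambda>x. bracket h x - \<nu> h *s x"
    have D: "endo ?D" by (intro endo_shift endo_bracket)
    have DV: "?D x \<in> V" if "x \<in> V" for x
      using V h that by (auto simp: P_def intro!: subspace_diff subspace_scale)
    have "\<exists>n. \<forall>x\<in>V. (?D ^^ n) x = 0"
      by (rule uniformly_nilpotent[OF D]) (use V h in \<open>auto simp: P_def weight_space_def gen_eigenspace_def\<close>)
    then obtain n where n: "\<forall>x\<in>V. (?D ^^ n) x = 0" by blast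
    have subU: "subspace (?D ` V)"
      by (rule subspace_image_endo[OF D]) (use V in \<open>simp add: P_def\<close>)
    have "?D ` V \<noteq> V"
    proof
      assume "?D ` V = V"
      then have "(?D ^^ k) ` V = V" for k
      proof (induction k)
        case (Suc k)
        have "(?D ^^ Suc k) ` V = ?D ` ((?D ^^ k) ` V)" by (simp only: funpow.simps image_comp)
        then show ?case using Suc \<open>?D ` V = V\<close> by (simp only:)
      qed simp
      then have "(?D ^^ n) ` V = V" .
      moreover have "(?D ^^ n) ` V \<subseteq> {0}" using n by blast
      ultimately have "V \<subseteq> {0}" by simp
      then show False using V subspace_0[of V] by (auto simp: P_def)
    qed
    have "?D ` V = {0}"
    proof (rule ccontr)
      assume nz: "?D ` V \<noteq> {0}"
      have "bracket h' (?D x) \<in> ?D ` V" if h': "h' \<in> T" and x: "x \<in> V" for h' x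
      proof -
        have "bracket h' (bracket h x) = bracket h (bracket h' x)"
          using bracket_derivation[of h' h x] T_abelian[OF h' h] by simp
        then have "bracket h' (?D x) = ?D (bracket h' x)"
          by (simp add: bracket_diff_right bracket_scale_right)
        then show ?thesis using V h' x by (auto simp: P_def)
      qed
      then have "P (?D ` V)" using subU nz DV V by (auto simp: P_def)
      then have "dim V \<le> dim (?D ` V)" by (rule min)
      moreover have "dim (?D ` V) < dim V"
        using subU V DV \<open>?D ` V \<noteq> V\<close> by (intro dim_strict_mono) (auto simp: P_def)
      ultimately show False by simp
    qed
    then have "?D v = 0" using v by blast
    then show ?thesis by simp
  qed
  obtain v where "v \<in> V" "v \<noteq> 0" using V subspace_0[of V] by (auto simp: P_def)
  then show ?thesis using eig V by (intro bexI[of _ v]) (auto simp: P_def)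
qed

text \<open>Invariance turns \<open>killing h [e,f]\<close> into \<open>killing [h,e] f\<close>, where \<open>e\<close> is an eigenvector. If \<open>\<nu>\<close> vanished
  on \<open>[e,f]\<close>, all weights would, and \<open>[e,f]\<close> would be \<open>0\<close>.\<close>

lemma sl2_pair:
  assumes \<nu>: "\<nu> \<in> weights" "\<nu> \<noteq> 0"
  obtains e f where "e \<in> weight_space \<nu>" "f \<in> weight_space (- \<nu>)" "killing e f = 1"
    "\<And>h. h \<in> T \<Longrightarrow> bracket h e = \<nu> h *s e"
    "\<And>h. h \<in> T \<Longrightarrow> killing h (bracket e f) = \<nu> h" "\<nu> (bracket e f) \<noteq> 0"
proof -
  obtain e where e: "e \<in> weight_space \<nu>" "e \<noteq> 0" "\<forall>h\<in>T. bracket h e = \<nu> h *s e"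
    using exists_eigenvector[OF \<nu>(1)] by blast
  obtain f where f: "f \<in> weight_space (- \<nu>)" "killing e f = 1"
    using weight_pairing[OF weights_vanish[OF \<nu>(1)] e(1,2)] by blast
  let ?h = "bracket e f"
  have hT: "?h \<in> T" by (rule weight_space_zero_sum[OF e(1) f(1)])
  have rep: "killing h ?h = \<nu> h" if "h \<in> T" for h
    unfolding killing_invariant[symmetric] using e(3) f(2) that by (simp add: killing_scale_left)
  have "\<nu> ?h \<noteq> 0"
  proof
    assume "\<nu> ?h = 0"
    then have "?h = 0"
      using weights_vanish_on_isotropic[OF weights_vanish[OF \<nu>(1)] e(1) f(1)] weights_separate_T[OF hT] by blast
    then have "\<nu> h = 0" for h
      using rep[of h] killing_0_right[of h] weights_vanish[OF \<nu>(1)] by (cases "h \<in> T") auto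
    then show False using \<nu>(2) by auto
  qed
  then show thesis using that e f rep by blast
qed

text \<open>Sum over the weights \<open>-n \<nu>\<close> with \<open>n \<ge> 1\<close>. Since \<open>[e,y]\<close> is the multiple \<open>killing e y\<close> of \<open>h\<close>
  for \<open>y\<close> of weight \<open>-\<nu>\<close>, the boundary term has rank one, and the sum says that \<open>\<Sum> n mult (-n \<nu>) = 1\<close>.\<close>

lemma mult_uminus_root:
  assumes \<nu>: "\<nu> \<in> weights" "\<nu> \<noteq> 0"
  shows "mult (- \<nu>) = 1"
proof -
  obtain e f where e: "e \<in> weight_space \<nu>" and f: "f \<in> weight_space (- \<nu>)" and ef: "killing e f = 1"
    and eig: "\<And>h. h \<in> T \<Longrightarrow> bracket h e = \<nu> h *s e"
    and rep: "\<And>h. h \<in> T \<Longrightarrow> killing h (bracket e f) = \<nu> h" and nz: "\<nu> (bracket e f) \<noteq> 0"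
    by (rule sl2_pair[OF \<nu>]) blast
  note off = weights_vanish[OF \<nu>(1)]
  let ?h = "bracket e f"
  have hT: "?h \<in> T" by (rule weight_space_zero_sum[OF e f])
  define mul where "mul n = (\<lambda>h. - of_nat n * \<nu> h)" for n :: nat
  have mul_diff: "mul n - \<nu> = mul (Suc n)" for n by (auto simp: mul_def algebra_simps)
  have inj: "m = n" if "mul m = mul n" for m n
    using fun_cong[OF that, of ?h] nz by (simp add: mul_def)
  have mul_1: "mul 1 = - \<nu>" by (auto simp: mul_def)
  let ?M = "{mul n | n. n \<ge> 1}" and ?M' = "{mul n | n. n \<ge> 2}"
  have M_shift: "\<kappa> \<in> ?M \<longleftrightarrow> \<kappa> - \<nu> \<in> ?M'" for \<kappa>
  proof
    assume "\<kappa> \<in> ?M"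
    then obtain n where "\<kappa> = mul n" "n \<ge> 1" by blast
    then show "\<kappa> - \<nu> \<in> ?M'" using mul_diff[of n] by (intro CollectI exI[of _ "Suc n"]) auto
  next
    assume "\<kappa> - \<nu> \<in> ?M'"
    then obtain n where n: "\<kappa> - \<nu> = mul n" "n \<ge> 2" by blast
    then obtain k where k: "n = Suc k" "k \<ge> 1" by (cases n) auto
    then have "\<kappa> - \<nu> = mul k - \<nu>" using n mul_diff by simp
    then show "\<kappa> \<in> ?M" using k by auto
  qed
  have M_split: "?M = insert (- \<nu>) ?M'"
  proof -
    have "n = 1 \<or> n \<ge> 2" if "n \<ge> 1" for n :: nat using that by linarith
    then have "?M \<subseteq> insert (- \<nu>) ?M'" using mul_1 by blast
    moreover have "insert (- \<nu>) ?M' \<subseteq> ?M" using mul_1[symmetric] by force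
    ultimately show ?thesis by blast
  qed
  have notin: "- \<nu> \<notin> ?M'"
  proof
    assume "- \<nu> \<in> ?M'"
    then obtain n where "mul 1 = mul n" "n \<ge> 2" using mul_1 by auto
    then show False using inj[of 1 n] by simp
  qed
  have minus_in: "- \<nu> \<in> weights" by (rule uminus_weight[OF \<nu>(1)])
  have proj_split: "proj ?M x = proj ?M' x + proj {- \<nu>} x" for x
    unfolding proj_def M_split using notin finite_weights minus_in by (simp add: add.commute)
  have ey: "bracket e y = killing e y *s ?h" if y: "y \<in> weight_space (- \<nu>)" for y
  proof -
    have "bracket e y - killing e y *s ?h = 0"
    proof (rule killing_nondegenerate_T)
      show "bracket e y - killing e y *s ?h \<in> T"
        using weight_space_zero_sum[OF e y] hT subspace_T by (intro subspace_diff subspace_scale)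
      fix h assume h: "h \<in> T"
      have "killing h (bracket e y) = \<nu> h * killing e y"
        by (simp add: killing_invariant[symmetric] eig[OF h] killing_scale_left)
      then have "killing h (bracket e y - killing e y *s ?h) = 0"
        by (simp add: killing_diff_right killing_scale_right rep[OF h])
      then show "killing (bracket e y - killing e y *s ?h) h = 0" by (simp add: killing_sym)
    qed
    then show ?thesis by simp
  qed
  have "trace (\<lambda>x. bracket f (bracket e (proj {- \<nu>} x))) = trace (\<lambda>x. killing e x *s bracket f ?h)"
    by (simp add: ey[OF proj_in_weight_space] killing_proj[OF off e] bracket_scale_right)
  also have "\<dots> = killing e (bracket f ?h)" by (rule trace_rank_one[OF functional_killing])
  also have "\<dots> = \<nu> ?h"
    by (subst killing_invariant[of e f ?h, symmetric]) (rule rep[OF hT])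
  finally have boundary: "trace (\<lambda>x. bracket f (bracket e (proj {- \<nu>} x))) = \<nu> ?h" .
  have "(\<Sum>\<kappa>\<in>?M \<inter> weights. \<kappa> ?h * of_nat (mult \<kappa>)) =
      trace (\<lambda>x. bracket f (bracket e (proj ?M' x))) - trace (\<lambda>x. bracket f (bracket e (proj ?M x)))"
    by (rule sum_weights_bracket[OF off e f M_shift])
  also have "\<dots> = - \<nu> ?h"
    unfolding proj_split by (simp add: bracket_add_right trace_add boundary)
  finally have sum: "(\<Sum>\<kappa>\<in>?M \<inter> weights. \<kappa> ?h * of_nat (mult \<kappa>)) = - \<nu> ?h" .
  have "\<forall>\<kappa>\<in>?M. \<exists>n. \<kappa> = mul n \<and> n \<ge> 1" by blast
  from bchoice[OF this] obtain n where n: "\<And>\<kappa>. \<kappa> \<in> ?M \<Longrightarrow> \<kappa> = mul (n \<kappa>) \<and> n \<kappa> \<ge> 1" by blast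
  have "(\<Sum>\<kappa>\<in>?M \<inter> weights. \<kappa> ?h * of_nat (mult \<kappa>)) =
      (\<Sum>\<kappa>\<in>?M \<inter> weights. - \<nu> ?h * of_nat (n \<kappa> * mult \<kappa>))"
  proof (rule sum.cong[OF refl])
    fix \<kappa> assume "\<kappa> \<in> ?M \<inter> weights"
    then have "\<kappa> = mul (n \<kappa>)" using n by blast
    then have "\<kappa> ?h = mul (n \<kappa>) ?h" by (rule fun_cong)
    then show "\<kappa> ?h * of_nat (mult \<kappa>) = - \<nu> ?h * of_nat (n \<kappa> * mult \<kappa>)" by (simp add: mul_def)
  qed
  also have "\<dots> = - \<nu> ?h * of_nat (\<Sum>\<kappa>\<in>?M \<inter> weights. n \<kappa> * mult \<kappa>)"
    by (simp only: sum_distrib_left of_nat_sum)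
  finally have "of_nat (\<Sum>\<kappa>\<in>?M \<inter> weights. n \<kappa> * mult \<kappa>) = (of_nat 1 :: 'k)" using sum nz by simp
  then have total: "(\<Sum>\<kappa>\<in>?M \<inter> weights. n \<kappa> * mult \<kappa>) = 1" by (simp only: of_nat_eq_iff)
  have in_M: "- \<nu> \<in> ?M \<inter> weights" using M_split minus_in by auto
  have "n (- \<nu>) * mult (- \<nu>) \<le> (\<Sum>\<kappa>\<in>?M \<inter> weights. n \<kappa> * mult \<kappa>)"
    by (rule member_le_sum[OF in_M]) (use finite_weights in auto)
  then have "n (- \<nu>) * mult (- \<nu>) \<le> 1" by (simp only: total)
  moreover have "n (- \<nu>) \<ge> 1" using n in_M by blast
  then have "1 * mult (- \<nu>) \<le> n (- \<nu>) * mult (- \<nu>)" by (rule mult_le_mono1)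
  ultimately show ?thesis using mult_pos[OF minus_in] by linarith
qed

lemma mult_root: "\<nu> \<in> weights \<Longrightarrow> \<nu> \<noteq> 0 \<Longrightarrow> mult \<nu> = 1"
  using mult_uminus_root[of "- \<nu>"] uminus_weight[of \<nu>] by simp

lemma weight_space_line:
  assumes \<nu>: "\<nu> \<in> weights" "\<nu> \<noteq> 0" and e: "e \<in> weight_space \<nu>" "e \<noteq> 0" and x: "x \<in> weight_space \<nu>"
  shows "\<exists>c. x = c *s e"
proof -
  have "weight_space \<nu> \<subseteq> span {e}"
    by (rule card_ge_dim_independent) (use e mult_root[OF \<nu>] in auto)
  then show ?thesis using x by (auto simp: span_singleton)
qed

lemma roots_eq: "roots T = weights - {0}"
proof (intro set_eqI iffI)
  fix \<nu> assume "\<nu> \<in> roots T"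
  then have \<nu>: "\<nu> \<in> dual_space T" "\<nu> \<noteq> 0" "root_space T \<nu> \<noteq> {0}" by (auto simp: roots_def)
  have "root_space T \<nu> \<subseteq> weight_space \<nu>"
    by (auto simp: root_space_def weight_space_def gen_eigenspace_def intro!: exI[of _ 1])
  moreover have "0 \<in> root_space T \<nu>" by (simp add: root_space_def)
  ultimately have "weight_space \<nu> \<noteq> {0}" using \<nu>(3) by blast
  then show "\<nu> \<in> weights - {0}" using \<nu> by (auto simp: weights_def dual_space_def)
next
  fix \<nu> assume \<nu>: "\<nu> \<in> weights - {0}"
  then obtain e where "e \<noteq> 0" "\<forall>h\<in>T. bracket h e = \<nu> h *s e"
    using exists_eigenvector[of \<nu>] by blast
  then show "\<nu> \<in> roots T" using \<nu> weight_dual[of \<nu>] by (auto simp: roots_def root_space_def)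
qed

lemma root_space_eq:
  assumes "\<nu> \<in> roots T"
  shows "root_space T \<nu> = weight_space \<nu>"
proof
  show "root_space T \<nu> \<subseteq> weight_space \<nu>"
    by (auto simp: root_space_def weight_space_def gen_eigenspace_def intro!: exI[of _ 1])
  have \<nu>: "\<nu> \<in> weights" "\<nu> \<noteq> 0" using assms by (auto simp: roots_eq)
  obtain e where e: "e \<in> weight_space \<nu>" "e \<noteq> 0" "\<forall>h\<in>T. bracket h e = \<nu> h *s e"
    using exists_eigenvector[OF \<nu>(1)] by blast
  show "weight_space \<nu> \<subseteq> root_space T \<nu>"
  proof
    fix x assume "x \<in> weight_space \<nu>"
    then obtain c where "x = c *s e" using weight_space_line[OF \<nu> e(1,2)] by blast
    then show "x \<in> root_space T \<nu>"
      using e(3) by (simp add: root_space_def bracket_scale_right scale_left_commute)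
  qed
qed

end

section \<open>Positivity along root strings\<close>

context simple_cartan_pair
begin

definition std_pair :: "('g \<Rightarrow> 'k) \<Rightarrow> 'g \<times> 'g \<Rightarrow> bool" where
  "std_pair \<nu> p \<longleftrightarrow> fst p \<in> weight_space \<nu> \<and> snd p \<in> weight_space (- \<nu>) \<and> killing (fst p) (snd p) = 1 \<and>
    (\<forall>h\<in>T. killing h (bracket (fst p) (snd p)) = \<nu> h) \<and> \<nu> (bracket (fst p) (snd p)) \<noteq> 0"

definition root_vec :: "('g \<Rightarrow> 'k) \<Rightarrow> 'g" where
  "root_vec \<nu> = fst (SOME p. std_pair \<nu> p)"

definition opp_vec :: "('g \<Rightarrow> 'k) \<Rightarrow> 'g" where
  "opp_vec \<nu> = snd (SOME p. std_pair \<nu> p)"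

text \<open>The element \<open>h\<^sub>\<nu>\<close> of \<open>T\<close> that represents \<open>\<nu>\<close> by the Killing form.\<close>

definition dual_vec :: "('g \<Rightarrow> 'k) \<Rightarrow> 'g" where
  "dual_vec \<nu> = bracket (root_vec \<nu>) (opp_vec \<nu>)"

lemma roots_weights: "\<nu> \<in> roots T \<Longrightarrow> \<nu> \<in> weights"
  and roots_nonzero: "\<nu> \<in> roots T \<Longrightarrow> \<nu> \<noteq> 0"
  by (auto simp: roots_eq)

lemma roots_vanish: "\<nu> \<in> roots T \<Longrightarrow> vanishes_off_T \<nu>"
  by (rule weights_vanish[OF roots_weights])

lemma
  assumes "\<nu> \<in> roots T"
  shows root_vec: "root_vec \<nu> \<in> weight_space \<nu>"
    and opp_vec: "opp_vec \<nu> \<in> weight_space (- \<nu>)"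
    and killing_root_vec: "killing (root_vec \<nu>) (opp_vec \<nu>) = 1"
    and killing_dual_vec: "h \<in> T \<Longrightarrow> killing h (dual_vec \<nu>) = \<nu> h"
    and dual_vec_nonzero: "\<nu> (dual_vec \<nu>) \<noteq> 0"
    and dual_vec_T: "dual_vec \<nu> \<in> T"
    and root_vec_nonzero: "root_vec \<nu> \<noteq> 0"
proof -
  obtain e f where "std_pair \<nu> (e, f)"
    by (rule sl2_pair[OF roots_weights[OF assms] roots_nonzero[OF assms]]) (auto simp: std_pair_def)
  then have *: "std_pair \<nu> (root_vec \<nu>, opp_vec \<nu>)"
    unfolding root_vec_def opp_vec_def prod.collapse by (rule someI)
  show "root_vec \<nu> \<in> weight_space \<nu>" "opp_vec \<nu> \<in> weight_space (- \<nu>)"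
    "killing (root_vec \<nu>) (opp_vec \<nu>) = 1" "h \<in> T \<Longrightarrow> killing h (dual_vec \<nu>) = \<nu> h"
    "\<nu> (dual_vec \<nu>) \<noteq> 0"
    using * by (auto simp: std_pair_def dual_vec_def)
  then show "dual_vec \<nu> \<in> T" by (simp add: dual_vec_def weight_space_zero_sum)
  show "root_vec \<nu> \<noteq> 0"
    using \<open>killing (root_vec \<nu>) (opp_vec \<nu>) = 1\<close> killing_0_right[of "opp_vec \<nu>"] by (auto simp: killing_sym)
qed

lemma proj_root:
  assumes \<nu>: "\<nu> \<in> roots T"
  shows "proj {\<nu>} x = killing (opp_vec \<nu>) x *s root_vec \<nu>"
proof -
  obtain c where c: "proj {\<nu>} x = c *s root_vec \<nu>"
    using weight_space_line[OF roots_weights[OF \<nu>] roots_nonzero[OF \<nu>] root_vec[OF \<nu>] root_vec_nonzero[OF \<nu>]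
        proj_in_weight_space] by blast
  have "killing (opp_vec \<nu>) (proj {- (- \<nu>)} x) = killing (opp_vec \<nu>) x"
    by (rule killing_proj[OF _ opp_vec[OF \<nu>]]) (use roots_vanish[OF \<nu>] in auto)
  then have "killing (opp_vec \<nu>) x = c"
    using killing_root_vec[OF \<nu>] by (simp add: c killing_scale_right killing_sym[of "opp_vec \<nu>" "root_vec \<nu>"])
  with c show ?thesis by simp
qed

lemma trace_proj_root:
  assumes "\<nu> \<in> roots T" "endo f"
  shows "trace (\<lambda>x. f (proj {\<nu>} x)) = killing (opp_vec \<nu>) (f (root_vec \<nu>))"
  by (simp add: proj_root[OF assms(1)] endo_scale[OF assms(2)] trace_rank_one[OF functional_killing])

text \<open>The eigenvalue of \<open>ad f\<^sub>\<gamma> ad e\<^sub>\<gamma>\<close> on the root space of \<open>\<delta>\<close>. It plays the role of the squared length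
  of \<open>[e\<^sub>\<gamma>, e\<^sub>\<delta>]\<close>.\<close>

definition interaction :: "('g \<Rightarrow> 'k) \<Rightarrow> ('g \<Rightarrow> 'k) \<Rightarrow> 'k" where
  "interaction \<gamma> \<delta> = killing (opp_vec \<delta>) (bracket (opp_vec \<gamma>) (bracket (root_vec \<gamma>) (root_vec \<delta>)))"

lemma interaction_trace:
  "\<delta> \<in> roots T \<Longrightarrow> trace (\<lambda>x. bracket (opp_vec \<gamma>) (bracket (root_vec \<gamma>) (proj {\<delta>} x))) = interaction \<gamma> \<delta>"
  unfolding interaction_def by (rule trace_proj_root[OF _ endo_comp[OF endo_bracket endo_bracket]])

text \<open>By invariance it is the Killing pairing of \<open>[f\<^sub>\<delta>, f\<^sub>\<gamma>]\<close> with \<open>[e\<^sub>\<gamma>, e\<^sub>\<delta>]\<close>; exchanging \<open>\<gamma>\<close> and \<open>\<delta>\<close>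
  changes the sign of both brackets.\<close>

lemma interaction_sym: "interaction \<gamma> \<delta> = interaction \<delta> \<gamma>"
proof -
  have "interaction \<gamma> \<delta> = killing (bracket (opp_vec \<delta>) (opp_vec \<gamma>)) (bracket (root_vec \<gamma>) (root_vec \<delta>))"
    by (simp add: interaction_def killing_invariant)
  also have "\<dots> = killing (bracket (opp_vec \<gamma>) (opp_vec \<delta>)) (bracket (root_vec \<delta>) (root_vec \<gamma>))"
    by (simp add: bracket_antisym[of "opp_vec \<delta>"] bracket_antisym[of "root_vec \<gamma>"] killing_minus_right
        killing_sym[of "- _"] killing_sym[of "bracket (root_vec \<delta>) (root_vec \<gamma>)"])
  also have "\<dots> = interaction \<delta> \<gamma>" by (simp add: interaction_def killing_invariant)
  finally show ?thesis .
qed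

lemma interaction_zero: "bracket (root_vec \<gamma>) (root_vec \<delta>) = 0 \<Longrightarrow> interaction \<gamma> \<delta> = 0"
  by (simp add: interaction_def killing_0_right)

text \<open>With \<open>N = \<gamma>(h\<^sub>\<gamma>)\<close> and \<open>\<nu>(h\<^sub>\<gamma>) = r\<^sub>\<nu> N\<close>, the identity \<open>N = killing h\<^sub>\<gamma> h\<^sub>\<gamma> = N\<^sup>2 \<Sum> r\<^sub>\<nu>\<^sup>2 mult \<nu>\<close>
  determines \<open>N\<close>.\<close>

lemma root_length_positive:
  assumes \<gamma>: "\<gamma> \<in> roots T"
  shows "\<exists>q>0. \<gamma> (dual_vec \<gamma>) = of_rat q"
proof -
  let ?h = "dual_vec \<gamma>" and ?N = "\<gamma> (dual_vec \<gamma>)"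
  have "\<forall>\<nu>\<in>weights. \<exists>r. \<nu> ?h = of_rat r * ?N"
    using string_rational[OF _ roots_vanish[OF \<gamma>]] root_vec[OF \<gamma>] opp_vec[OF \<gamma>] unfolding dual_vec_def by blast
  from bchoice[OF this] obtain r where r: "\<And>\<nu>. \<nu> \<in> weights \<Longrightarrow> \<nu> ?h = of_rat (r \<nu>) * ?N" by blast
  define R where "R = (\<Sum>\<nu>\<in>weights. (r \<nu>)\<^sup>2 * of_nat (mult \<nu>))"
  have "?N = killing ?h ?h" by (rule killing_dual_vec[OF \<gamma> dual_vec_T[OF \<gamma>], symmetric])
  also have "\<dots> = ?N\<^sup>2 * of_rat R"
    unfolding killing_T_self[OF dual_vec_T[OF \<gamma>]] R_def of_rat_sum sum_distrib_left
    by (intro sum.cong refl) (simp add: r of_rat_mult of_rat_power power_mult_distrib mult_ac)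
  finally have NR: "?N * of_rat R = 1"
    using dual_vec_nonzero[OF \<gamma>] by (simp add: power2_eq_square)
  have "R \<ge> 0" unfolding R_def by (intro sum_nonneg) auto
  moreover have "R \<noteq> 0" using NR by auto
  ultimately have "1 / R > 0" by simp
  moreover have "?N = of_rat (1 / R)" using NR \<open>R \<noteq> 0\<close> by (simp add: of_rat_divide field_simps)
  ultimately show ?thesis by blast
qed

text \<open>Along the \<open>\<gamma>\<close>-string through \<open>\<delta>\<close> the numbers \<open>\<nu>(h\<^sub>\<gamma>)\<close> increase, and they sum to zero with
  multiplicities. The interaction is the sum over the part beyond \<open>\<delta>\<close>, and also minus the sum over
  the rest. At least one of these two sums has summands of a single sign.\<close>

lemma interaction_nonneg:
  assumes \<gamma>: "\<gamma> \<in> roots T" and \<delta>: "\<delta> \<in> roots T"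
  shows "\<exists>q\<ge>0. interaction \<gamma> \<delta> = of_rat q \<and> (\<gamma> + \<delta> \<in> weights \<longrightarrow> q > 0)"
proof -
  let ?h = "dual_vec \<gamma>"
  let ?tr = "\<lambda>M. trace (\<lambda>x. bracket (opp_vec \<gamma>) (bracket (root_vec \<gamma>) (proj M x)))"
  obtain N where N: "N > 0" "\<gamma> ?h = of_rat N" using root_length_positive[OF \<gamma>] by blast
  obtain r where r: "\<delta> ?h = of_rat r * of_rat N"
    using string_rational[OF roots_weights[OF \<delta>] roots_vanish[OF \<gamma>]] root_vec[OF \<gamma>] opp_vec[OF \<gamma>] N(2)
    unfolding dual_vec_def by metis
  define str where "str j = (\<lambda>h. \<delta> h + of_int j * \<gamma> h)" for j :: int
  have str_diff: "str j - \<gamma> = str (j - 1)" for j by (auto simp: str_def algebra_simps)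
  have inj: "i = j" if "str i = str j" for i j
    using fun_cong[OF that, of ?h] dual_vec_nonzero[OF \<gamma>] by (simp add: str_def)
  have str_0: "str 0 = \<delta>" and str_1: "str 1 = \<gamma> + \<delta>" by (auto simp: str_def)
  have shift: "\<nu> \<in> str ` J \<longleftrightarrow> \<nu> - \<gamma> \<in> str ` ((\<lambda>j. j - 1) ` J)" for \<nu> J
  proof
    assume "\<nu> \<in> str ` J"
    then show "\<nu> - \<gamma> \<in> str ` ((\<lambda>j. j - 1) ` J)" using str_diff by auto
  next
    assume "\<nu> - \<gamma> \<in> str ` ((\<lambda>j. j - 1) ` J)"
    then obtain j where j: "j \<in> J" "\<nu> - \<gamma> = str (j - 1)" by auto
    then have "\<nu> - \<gamma> = str j - \<gamma>" using str_diff by simp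
    then have "\<nu> = str j" by simp
    then show "\<nu> \<in> str ` J" using j by blast
  qed
  define idx where "idx \<nu> = (THE j. \<nu> = str j)" for \<nu>
  have idx: "idx (str j) = j" for j unfolding idx_def using inj by blast
  define \<sigma> where "\<sigma> J = (\<Sum>\<nu>\<in>str ` J \<inter> weights. (r + of_int (idx \<nu>)) * of_nat (mult \<nu>))" for J
  have tail: "of_rat (N * \<sigma> J) = ?tr (str ` ((\<lambda>j. j - 1) ` J)) - ?tr (str ` J)" for J
  proof -
    have "of_rat (N * \<sigma> J) = (\<Sum>\<nu>\<in>str ` J \<inter> weights. \<nu> ?h * of_nat (mult \<nu>))"
      unfolding \<sigma>_def sum_distrib_left of_rat_sum
    proof (rule sum.cong[OF refl])
      fix \<nu> assume "\<nu> \<in> str ` J \<inter> weights"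
      then obtain j where j: "\<nu> = str j" by blast
      have "str j ?h = of_rat (N * (r + of_int j))"
        by (simp add: str_def r N(2) of_rat_mult of_rat_add algebra_simps)
      then show "of_rat (N * ((r + of_int (idx \<nu>)) * of_nat (mult \<nu>))) = \<nu> ?h * of_nat (mult \<nu>)"
        unfolding j idx mult.assoc[symmetric] of_rat_mult[of "_ * _" "of_nat _"] of_rat_of_nat_eq by (simp only:)
    qed
    also have "\<dots> = ?tr (str ` ((\<lambda>j. j - 1) ` J)) - ?tr (str ` J)"
      unfolding dual_vec_def
      by (rule sum_weights_bracket[OF roots_vanish[OF \<gamma>] root_vec[OF \<gamma>] opp_vec[OF \<gamma>] shift])
    finally show ?thesis .
  qed
  have split: "?tr (str ` insert 0 J) = interaction \<gamma> \<delta> + ?tr (str ` J)" if "0 \<notin> J" for J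
  proof -
    have "\<delta> \<notin> str ` J" using that inj[of 0] str_0 by auto
    then have "proj (str ` insert 0 J) x = proj {\<delta>} x + proj (str ` J) x" for x
      unfolding proj_def using roots_weights[OF \<delta>] finite_weights by (simp add: str_0)
    then show ?thesis
      by (simp add: bracket_add_right trace_add interaction_trace[OF \<delta>])
  qed
  have up: "(\<lambda>j. j - 1) ` {1..} = insert 0 {1 :: int..}"
    by (auto simp: image_iff intro!: bexI[of _ "_ + 1"])
  have down: "(\<lambda>j. j - 1) ` {..0} = {..-1 :: int}" "{..0} = insert 0 {..-1 :: int}"
    by (auto simp: image_iff intro!: bexI[of _ "_ + 1"])
  have pos: "interaction \<gamma> \<delta> = of_rat (N * \<sigma> {1..})"
    unfolding tail up using split[of "{1..}"] by simp
  have neg: "interaction \<gamma> \<delta> = of_rat (N * - \<sigma> {..0})"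
    using tail[of "{..0}"] split[of "{..-1}"] unfolding down(1) unfolding down(2)
    by (simp add: of_rat_minus)
  show ?thesis
  proof (cases "r + 1 > 0")
    case True
    have summand: "(r + of_int (idx \<nu>)) * of_nat (mult \<nu>) \<ge> 0" if "\<nu> \<in> str ` {1..} \<inter> weights" for \<nu>
    proof -
      from that obtain j where j: "\<nu> = str j" "j \<ge> 1" by auto
      then have "r + of_int j \<ge> 0" using True of_int_le_iff[of 1 j, where ?'a = rat] by linarith
      then show ?thesis by (simp add: j idx)
    qed
    then have "\<sigma> {1..} \<ge> 0" unfolding \<sigma>_def by (rule sum_nonneg)
    moreover have "\<sigma> {1..} > 0" if w: "\<gamma> + \<delta> \<in> weights"
      unfolding \<sigma>_def
    proof (rule sum_pos2[OF _ _ _ summand])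
      show in_str: "\<gamma> + \<delta> \<in> str ` {1..} \<inter> weights" using w str_1[symmetric] by auto
      show "(r + of_int (idx (\<gamma> + \<delta>))) * of_nat (mult (\<gamma> + \<delta>)) > 0"
        using True mult_pos[OF w] idx[of 1] str_1 by (intro mult_pos_pos) (simp_all only: of_int_1 of_nat_0_less_iff)
    qed (use finite_weights in auto)
    ultimately show ?thesis using N(1) pos by (intro exI[of _ "N * \<sigma> {1..}"]) auto
  next
    case False
    have summand: "- ((r + of_int (idx \<nu>)) * of_nat (mult \<nu>)) \<ge> 0" if "\<nu> \<in> str ` {..0} \<inter> weights" for \<nu>
    proof -
      from that obtain j where j: "\<nu> = str j" "j \<le> 0" by auto
      then have "r + of_int j \<le> 0" using False of_int_le_iff[of j 0, where ?'a = rat] by linarith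
      then show ?thesis by (simp add: j idx mult_nonpos_nonneg)
    qed
    have "- \<sigma> {..0} > 0"
      unfolding \<sigma>_def sum_negf[symmetric]
    proof (rule sum_pos2[OF _ _ _ summand])
      show "\<delta> \<in> str ` {..0} \<inter> weights" using roots_weights[OF \<delta>] str_0[symmetric] by auto
      have "(r + of_int (idx \<delta>)) * of_nat (mult \<delta>) < 0"
        using False mult_pos[OF roots_weights[OF \<delta>]] idx[of 0] str_0
        by (intro mult_neg_pos) (simp_all only: of_int_0 of_nat_0_less_iff)
      then show "0 < - ((r + of_int (idx \<delta>)) * of_nat (mult \<delta>))" by simp
    qed (use finite_weights in auto)
    then have "N * - \<sigma> {..0} > 0" using N(1) by (intro mult_pos_pos)
    then show ?thesis using neg by (intro exI[of _ "N * - \<sigma> {..0}"]) linarith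
  qed
qed

end

lemma sum_fun_apply: "(\<Sum>i\<in>I. f i) x = (\<Sum>i\<in>I. f i x)"
  for f :: "'i \<Rightarrow> 'x \<Rightarrow> 'y::comm_monoid_add"
  by (induction I rule: infinite_finite_induct) auto

section \<open>The grading by the height at a simple root\<close>

locale graded_simple = simple_cartan_pair scale Basis bracket T
  for scale :: "'k::{alg_closed_field, field_char_0} \<Rightarrow> 'g::ab_group_add \<Rightarrow> 'g" (infixr "*s" 75)
    and Basis and bracket :: "'g \<Rightarrow> 'g \<Rightarrow> 'g" and T +
  fixes B :: "('g \<Rightarrow> 'k) set" and \<alpha> :: "'g \<Rightarrow> 'k"
  assumes simple: "simple_roots T B" and \<alpha>: "\<alpha> \<in> B"
begin

lemma finite_B: "finite B"
  and B_roots: "\<beta> \<in> B \<Longrightarrow> \<beta> \<in> roots T"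
  and B_independent: "\<not> module.dependent (\<lambda>c f h. c * f h) B"
  and root_expansion_exists: "\<gamma> \<in> roots T \<Longrightarrow> \<exists>n. is_root_expansion B \<gamma> n"
  using simple by (auto simp: simple_roots_def)

lemma root_expansion_unique:
  assumes "is_root_expansion B \<gamma> m" "is_root_expansion B \<gamma> n"
  shows "m = n"
proof -
  interpret F: vector_space "\<lambda>c (f :: 'g \<Rightarrow> 'k) h. c * f h"
    by unfold_locales (auto simp: algebra_simps)
  have "(\<Sum>\<beta>\<in>B. (\<lambda>h. of_int (m \<beta> - n \<beta>) * \<beta> h)) =
      (\<Sum>\<beta>\<in>B. (\<lambda>h. of_int (m \<beta>) * \<beta> h) - (\<lambda>h. of_int (n \<beta>) * \<beta> h))"
    by (intro sum.cong refl) (auto simp: algebra_simps)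
  also have "\<dots> = 0"
    unfolding sum_subtractf using assms by (auto simp: is_root_expansion_def)
  finally have 0: "(\<Sum>\<beta>\<in>B. (\<lambda>h. of_int (m \<beta> - n \<beta>) * \<beta> h)) = 0" .
  have "of_int (m \<beta> - n \<beta>) = (0 :: 'k)" if "\<beta> \<in> B" for \<beta>
    using F.independentD[OF B_independent finite_B subset_refl 0 that] .
  then have "m \<beta> = n \<beta>" for \<beta>
    using assms by (cases "\<beta> \<in> B") (auto simp: is_root_expansion_def)
  then show ?thesis by auto
qed

definition coeffs :: "('g \<Rightarrow> 'k) \<Rightarrow> ('g \<Rightarrow> 'k) \<Rightarrow> int" where
  "coeffs \<gamma> = (THE n. is_root_expansion B \<gamma> n)"

lemma coeffs_eqI: "is_root_expansion B \<gamma> n \<Longrightarrow> coeffs \<gamma> = n"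
  unfolding coeffs_def using root_expansion_unique by blast

lemma root_expansion_0: "is_root_expansion B 0 (\<lambda>_. 0)"
  by (auto simp: is_root_expansion_def fun_eq_iff sum_fun_apply)

lemma root_expansion_coeffs: "\<gamma> \<in> weights \<Longrightarrow> is_root_expansion B \<gamma> (coeffs \<gamma>)"
  using root_expansion_0 root_expansion_exists[of \<gamma>] coeffs_eqI by (cases "\<gamma> = 0") (auto simp: roots_eq)

lemma root_expansion_add:
  assumes "is_root_expansion B \<gamma> m" "is_root_expansion B \<delta> n"
  shows "is_root_expansion B (\<gamma> + \<delta>) (\<lambda>\<beta>. m \<beta> + n \<beta>)"
proof -
  have "(\<Sum>\<beta>\<in>B. (\<lambda>h. of_int (m \<beta> + n \<beta>) * \<beta> h)) =
      (\<Sum>\<beta>\<in>B. (\<lambda>h. of_int (m \<beta>) * \<beta> h) + (\<lambda>h. of_int (n \<beta>) * \<beta> h))"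
    by (intro sum.cong refl) (auto simp: algebra_simps)
  then show ?thesis using assms by (auto simp: is_root_expansion_def sum.distrib)
qed

lemma coeffs_diff:
  assumes "\<nu> \<in> weights" "\<gamma> \<in> weights" "\<nu> - \<gamma> \<in> weights"
  shows "coeffs (\<nu> - \<gamma>) \<beta> = coeffs \<nu> \<beta> - coeffs \<gamma> \<beta>"
proof -
  have "is_root_expansion B (\<nu> - \<gamma> + \<gamma>) (\<lambda>\<beta>. coeffs (\<nu> - \<gamma>) \<beta> + coeffs \<gamma> \<beta>)"
    by (intro root_expansion_add root_expansion_coeffs assms)
  then have "coeffs \<nu> = (\<lambda>\<beta>. coeffs (\<nu> - \<gamma>) \<beta> + coeffs \<gamma> \<beta>)" by (intro coeffs_eqI) simp
  then show ?thesis by simp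
qed

lemma coeffs_simple:
  assumes "\<beta> \<in> B"
  shows "coeffs \<beta> = (\<lambda>\<beta>'. if \<beta>' = \<beta> then 1 else 0)"
proof (rule coeffs_eqI)
  have "(\<Sum>\<beta>'\<in>B. (\<lambda>h. of_int (if \<beta>' = \<beta> then 1 else 0) * \<beta>' h)) = (\<Sum>\<beta>'\<in>B. if \<beta>' = \<beta> then \<beta> else 0)"
    by (intro sum.cong refl) auto
  also have "\<dots> = \<beta>" using assms finite_B by (simp add: sum.delta)
  finally show "is_root_expansion B \<beta> (\<lambda>\<beta>'. if \<beta>' = \<beta> then 1 else 0)"
    using assms by (auto simp: is_root_expansion_def)
qed

definition level :: "int \<Rightarrow> ('g \<Rightarrow> 'k) set" where
  "level i = {\<nu> \<in> weights. coeffs \<nu> \<alpha> = i}"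

lemma level_weights: "level i \<inter> weights = level i"
  by (auto simp: level_def)

lemma finite_level: "finite (level i)"
  using finite_weights by (auto simp: level_def)

lemma level_1_roots: "level 1 \<subseteq> roots T"
  using coeffs_eqI[OF root_expansion_0] by (auto simp: level_def roots_eq)

lemma roots_of_height_eq: "roots_of_height T B \<alpha> 1 = level 1"
  using level_1_roots by (auto simp: roots_of_height_def height_def level_def coeffs_def roots_eq)

definition level_sum :: "int \<Rightarrow> 'g \<Rightarrow> 'k" where
  "level_sum i h = (\<Sum>\<nu>\<in>level i. \<nu> h * of_nat (mult \<nu>))"

definition level_trace :: "('g \<Rightarrow> 'k) \<Rightarrow> int \<Rightarrow> 'k" where
  "level_trace \<gamma> i = trace (\<lambda>x. bracket (opp_vec \<gamma>) (bracket (root_vec \<gamma>) (proj (level i) x)))"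

lemma level_sum_dual_vec:
  assumes \<gamma>: "\<gamma> \<in> roots T"
  shows "level_sum i (dual_vec \<gamma>) = level_trace \<gamma> (i - coeffs \<gamma> \<alpha>) - level_trace \<gamma> i"
proof -
  have "\<nu> \<in> level i \<longleftrightarrow> \<nu> - \<gamma> \<in> level (i - coeffs \<gamma> \<alpha>)" if "\<nu> \<in> weights" "\<nu> - \<gamma> \<in> weights" for \<nu>
    using that roots_weights[OF \<gamma>] by (simp add: level_def coeffs_diff)
  from sum_weights_bracket[OF roots_vanish[OF \<gamma>] root_vec[OF \<gamma>] opp_vec[OF \<gamma>] this]
  show ?thesis by (simp add: level_sum_def level_trace_def dual_vec_def level_weights)
qed

lemma level_sum_add: "h \<in> T \<Longrightarrow> h' \<in> T \<Longrightarrow> level_sum i (h + h') = level_sum i h + level_sum i h'"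
  unfolding level_sum_def sum.distrib[symmetric]
  by (intro sum.cong refl) (auto simp: level_def weight_add algebra_simps)

lemma level_sum_scale: "h \<in> T \<Longrightarrow> level_sum i (c *s h) = c * level_sum i h"
  unfolding level_sum_def sum_distrib_left
  by (intro sum.cong refl) (auto simp: level_def weight_scale)

lemma level_sum_sum:
  "(\<And>\<beta>. \<beta> \<in> F \<Longrightarrow> h \<beta> \<in> T) \<Longrightarrow> level_sum i (\<Sum>\<beta>\<in>F. c \<beta> *s h \<beta>) = (\<Sum>\<beta>\<in>F. c \<beta> * level_sum i (h \<beta>))"
proof (induction F rule: infinite_finite_induct)
  case (insert \<beta> F)
  have "(\<Sum>\<beta>\<in>F. c \<beta> *s h \<beta>) \<in> T"
    using insert.prems by (intro subspace_sum[OF subspace_T] subspace_scale[OF subspace_T]) auto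
  then show ?case using insert subspace_T by (simp add: level_sum_add level_sum_scale subspace_scale)
qed (auto simp: level_sum_def level_def weight_at_0)

lemma dual_vec_expansion:
  assumes \<gamma>: "\<gamma> \<in> roots T"
  shows "dual_vec \<gamma> = (\<Sum>\<beta>\<in>B. of_int (coeffs \<gamma> \<beta>) *s dual_vec \<beta>)" (is "_ = ?s")
proof -
  have sT: "?s \<in> T"
    by (intro subspace_sum[OF subspace_T] subspace_scale[OF subspace_T] dual_vec_T B_roots)
  have "dual_vec \<gamma> - ?s = 0"
  proof (rule killing_nondegenerate_T)
    show "dual_vec \<gamma> - ?s \<in> T" by (rule subspace_diff[OF subspace_T dual_vec_T[OF \<gamma>] sT])
    fix h assume h: "h \<in> T"
    have "\<gamma> = (\<Sum>\<beta>\<in>B. (\<lambda>h. of_int (coeffs \<gamma> \<beta>) * \<beta> h))"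
      using root_expansion_coeffs[OF roots_weights[OF \<gamma>]] by (simp add: is_root_expansion_def)
    then have "\<gamma> h = (\<Sum>\<beta>\<in>B. (\<lambda>h. of_int (coeffs \<gamma> \<beta>) * \<beta> h)) h" by (rule fun_cong)
    also have "\<dots> = (\<Sum>\<beta>\<in>B. of_int (coeffs \<gamma> \<beta>) * \<beta> h)"
      by (rule sum_fun_apply)
    also have "\<dots> = killing h ?s"
      by (simp add: killing_sum_right killing_scale_right killing_dual_vec[OF B_roots h])
    finally have "killing h (dual_vec \<gamma> - ?s) = 0"
      by (simp add: killing_diff_right killing_dual_vec[OF \<gamma> h])
    then show "killing (dual_vec \<gamma> - ?s) h = 0" by (simp add: killing_sym)
  qed
  then show ?thesis by simp
qed

text \<open>The traces of \<open>ad h\<^sub>\<beta>\<close> on the graded parts vanish for simple \<open>\<beta> \<noteq> \<alpha>\<close>, because \<open>h\<^sub>\<beta>\<close> is a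
  commutator in degree \<open>0\<close>. So only the \<open>\<alpha>\<close>-coefficient of \<open>\<gamma>\<close> matters.\<close>

lemma level_sum_level_1:
  assumes \<gamma>: "\<gamma> \<in> level 1"
  shows "level_sum i (dual_vec \<gamma>) = level_sum i (dual_vec \<alpha>)"
proof -
  have "level_sum i (dual_vec \<gamma>) = (\<Sum>\<beta>\<in>B. of_int (coeffs \<gamma> \<beta>) * level_sum i (dual_vec \<beta>))"
    using \<gamma> level_1_roots
    by (subst dual_vec_expansion[of \<gamma>]) (blast, rule level_sum_sum, rule dual_vec_T, rule B_roots)
  also have "\<dots> = (\<Sum>\<beta>\<in>B. if \<beta> = \<alpha> then level_sum i (dual_vec \<alpha>) else 0)"
  proof (intro sum.cong refl)
    fix \<beta> assume \<beta>: "\<beta> \<in> B"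
    show "of_int (coeffs \<gamma> \<beta>) * level_sum i (dual_vec \<beta>) = (if \<beta> = \<alpha> then level_sum i (dual_vec \<alpha>) else 0)"
      using \<gamma> level_sum_dual_vec[OF B_roots[OF \<beta>], of i] by (auto simp: level_def coeffs_simple[OF \<beta>])
  qed
  also have "\<dots> = level_sum i (dual_vec \<alpha>)" using finite_B \<alpha> by (simp add: sum.delta)
  finally show ?thesis .
qed

text \<open>Lowering the degree by one adds \<open>level_sum i h\<^sub>\<gamma>\<close>, which is the same for all \<open>\<gamma>\<close>, and above the
  largest degree all traces vanish.\<close>

lemma level_trace_independent:
  assumes \<gamma>: "\<gamma> \<in> level 1" and \<delta>: "\<delta> \<in> level 1"
  shows "level_trace \<gamma> i = level_trace \<delta> i"
proof -
  obtain K where K: "\<And>\<nu>. \<nu> \<in> weights \<Longrightarrow> coeffs \<nu> \<alpha> < K"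
  proof
    fix \<nu> assume "\<nu> \<in> weights"
    then have "coeffs \<nu> \<alpha> \<le> Max ((\<lambda>\<nu>. coeffs \<nu> \<alpha>) ` weights)"
      by (intro Max_ge) (auto simp: finite_weights)
    then show "coeffs \<nu> \<alpha> < Max ((\<lambda>\<nu>. coeffs \<nu> \<alpha>) ` weights) + 1" by simp
  qed
  have top: "level_trace \<kappa> i = 0" if "i \<ge> K" for \<kappa> i
  proof -
    have "level i = {}" using K that by (force simp: level_def)
    then show ?thesis by (simp add: level_trace_def proj_def trace_zero)
  qed
  have step: "level_trace \<kappa> (i - 1) = level_trace \<kappa> i + level_sum i (dual_vec \<alpha>)" if "\<kappa> \<in> level 1" for \<kappa> i
    using level_sum_dual_vec[of \<kappa> i] level_sum_level_1[OF that, of i] that level_1_roots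
    by (auto simp: level_def)
  have "level_trace \<gamma> i = level_trace \<delta> i" if "i \<le> K" for i
    using that by (induction i rule: int_le_induct) (simp_all add: top step[OF \<gamma>] step[OF \<delta>])
  then show ?thesis using top by (cases "i \<le> K") auto
qed

lemma sum_interaction:
  "(\<Sum>\<delta>\<in>level 1. interaction \<gamma> \<delta>) = level_trace \<gamma> 1"
  unfolding level_trace_def
  by (subst trace_compose_proj[OF endo_comp[OF endo_bracket endo_bracket]])
    (use level_1_roots in \<open>auto simp: level_weights interaction_trace intro!: sum.cong\<close>)

end

text \<open>Let \<open>w\<close> be a nonnegative weighting of the edges of a graph with the same total weight \<open>c\<close> at each
  vertex. If \<open>S\<close> is independent, the edges between \<open>S\<close> and its complement carry the weight \<open>c |S|\<close>. If
  the complement has as many vertices, this is all the weight there is at its vertices, and nothing is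
  left for edges inside the complement.\<close>

lemma half_independent_complement:
  fixes w :: "'i \<Rightarrow> 'i \<Rightarrow> rat"
  assumes L: "finite L" and S: "S \<subseteq> L" "card L = 2 * card S"
    and nonneg: "\<And>i j. i \<in> L \<Longrightarrow> j \<in> L \<Longrightarrow> w i j \<ge> 0"
    and sym: "\<And>i j. i \<in> L \<Longrightarrow> j \<in> L \<Longrightarrow> w i j = w j i"
    and const: "\<And>i. i \<in> L \<Longrightarrow> (\<Sum>j\<in>L. w i j) = c"
    and indep: "\<And>i j. i \<in> S \<Longrightarrow> j \<in> S \<Longrightarrow> w i j = 0"
    and ij: "i \<in> L - S" "j \<in> L - S"
  shows "w i j = 0"
proof -
  have fin: "finite S" "finite (L - S)" using L S finite_subset by auto
  have card: "card (L - S) = card S" using S L by (simp add: card_Diff_subset finite_subset)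
  have split: "(\<Sum>j\<in>L. w i j) = (\<Sum>j\<in>S. w i j) + (\<Sum>j\<in>L - S. w i j)" for i
    using sum.subset_diff[OF S(1) L, of "w i"] by simp
  have 1: "of_nat (card S) * c = (\<Sum>i\<in>S. \<Sum>j\<in>L - S. w i j)"
  proof -
    have "(\<Sum>i\<in>S. \<Sum>j\<in>L. w i j) = of_nat (card S) * c" using const S by (simp add: subset_iff)
    moreover have "(\<Sum>i\<in>S. \<Sum>j\<in>L. w i j) = (\<Sum>i\<in>S. \<Sum>j\<in>L - S. w i j)"
      unfolding split by (intro sum.cong refl) (simp add: indep)
    ultimately show ?thesis by simp
  qed
  have "(\<Sum>i\<in>L - S. \<Sum>j\<in>L. w i j) = of_nat (card S) * c" using const by (simp add: card)
  then have "(\<Sum>i\<in>L - S. \<Sum>j\<in>S. w i j) + (\<Sum>i\<in>L - S. \<Sum>j\<in>L - S. w i j) = of_nat (card S) * c"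
    unfolding split sum.distrib .
  moreover have "(\<Sum>i\<in>L - S. \<Sum>j\<in>S. w i j) = (\<Sum>i\<in>S. \<Sum>j\<in>L - S. w i j)"
    by (subst sum.swap) (use S sym in \<open>auto intro!: sum.cong\<close>)
  ultimately have "(\<Sum>i\<in>L - S. \<Sum>j\<in>L - S. w i j) = 0" using 1 by simp
  then have "(\<Sum>j\<in>L - S. w i j) = 0"
    using fin ij nonneg by (subst (asm) sum_nonneg_eq_0_iff) (auto intro!: sum_nonneg)
  then show ?thesis using fin ij nonneg by (subst (asm) sum_nonneg_eq_0_iff) auto
qed

context graded_simple
begin

text \<open>The interactions are such a weighting on the roots of degree \<open>1\<close>: the total weight at \<open>\<gamma>\<close> is the
  trace of \<open>ad f\<^sub>\<gamma> ad e\<^sub>\<gamma>\<close> on the first graded part, and an edge has weight \<open>0\<close> only if the root vectors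
  commute.\<close>

lemma half_commuting_complement:
  assumes S: "S \<subseteq> level 1" "card (level 1) = 2 * card S"
    and comm: "\<And>\<gamma> \<delta>. \<gamma> \<in> S \<Longrightarrow> \<delta> \<in> S \<Longrightarrow> bracket (root_vec \<gamma>) (root_vec \<delta>) = 0"
    and \<gamma>\<delta>: "\<gamma> \<in> level 1 - S" "\<delta> \<in> level 1 - S"
  shows "bracket (root_vec \<gamma>) (root_vec \<delta>) = 0"
proof -
  have roots: "\<gamma> \<in> roots T" if "\<gamma> \<in> level 1" for \<gamma> using that level_1_roots by blast
  have "\<exists>q\<ge>0. interaction \<gamma> \<delta> = of_rat q" if "\<gamma> \<in> level 1" "\<delta> \<in> level 1" for \<gamma> \<delta>
    using interaction_nonneg[OF roots roots, OF that] by blast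
  then obtain w where w: "\<And>\<gamma> \<delta>. \<gamma> \<in> level 1 \<Longrightarrow> \<delta> \<in> level 1 \<Longrightarrow> w \<gamma> \<delta> \<ge> 0 \<and> interaction \<gamma> \<delta> = of_rat (w \<gamma> \<delta>)"
    by metis
  have row: "of_rat (\<Sum>\<delta>\<in>level 1. w \<kappa> \<delta>) = level_trace \<kappa> 1" if "\<kappa> \<in> level 1" for \<kappa>
    unfolding sum_interaction[symmetric] of_rat_sum by (intro sum.cong refl) (use w that in auto)
  have "w \<gamma> \<delta> = 0"
  proof (rule half_independent_complement[OF finite_level S])
    show "w i j = w j i" if "i \<in> level 1" "j \<in> level 1" for i j
      using w[OF that] w[OF that(2,1)] interaction_sym[of i j] by simp
    show "(\<Sum>j\<in>level 1. w i j) = (\<Sum>j\<in>level 1. w \<gamma> j)" if "i \<in> level 1" for i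
    proof -
      have "\<gamma> \<in> level 1" using \<gamma>\<delta> by blast
      from row[OF that] row[OF this] level_trace_independent[OF that this]
      have "(of_rat (\<Sum>j\<in>level 1. w i j) :: 'k) = of_rat (\<Sum>j\<in>level 1. w \<gamma> j)" by simp
      then show ?thesis by (simp only: of_rat_eq_iff)
    qed
    show "w i j = 0" if "i \<in> S" "j \<in> S" for i j
      using interaction_zero[OF comm[OF that]] w[of i j] that S(1) by auto
  qed (use w \<gamma>\<delta> in auto)
  moreover have "\<gamma> \<in> level 1" "\<delta> \<in> level 1" using \<gamma>\<delta> by auto
  note this[THEN roots]
  ultimately have "\<gamma> + \<delta> \<notin> weights"
    using interaction_nonneg[of \<gamma> \<delta>] w[of \<gamma> \<delta>] \<gamma>\<delta> by auto
  moreover have "vanishes_off_T (\<gamma> + \<delta>)"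
    using roots_vanish[of \<gamma>] roots_vanish[of \<delta>] \<open>\<gamma> \<in> roots T\<close> \<open>\<delta> \<in> roots T\<close> by simp
  ultimately show ?thesis
    using bracket_weight_space[OF root_vec root_vec, OF \<open>\<gamma> \<in> roots T\<close> \<open>\<delta> \<in> roots T\<close>] weight_space_trivial by blast
qed

end

section \<open>Leading root vectors and the complement\<close>

text \<open>The differences of the polynomials have only finitely many roots.\<close>

lemma exists_separating_point:
  fixes P :: "int poly set"
  assumes "finite P"
  shows "\<exists>m. inj_on (\<lambda>p. poly p m) P"
proof -
  let ?Z = "\<Union>pq\<in>{pq \<in> P \<times> P. fst pq \<noteq> snd pq}. {m. poly (fst pq - snd pq) m = 0}"
  have "finite ?Z" using assms by (intro finite_UN_I poly_roots_finite) auto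
  then obtain m where m: "m \<notin> ?Z" using ex_new_if_finite[OF infinite_UNIV_int] by blast
  have "inj_on (\<lambda>p. poly p m) P"
  proof (rule inj_onI, rule ccontr)
    fix p q assume pq: "p \<in> P" "q \<in> P" "poly p m = poly q m" "p \<noteq> q"
    then have "m \<in> ?Z" by (intro UN_I[of "(p, q)"]) auto
    then show False using m by blast
  qed
  then show ?thesis ..
qed

context graded_simple
begin

text \<open>Turn the coefficients of a root in the basis \<open>B\<close> into those of a polynomial, and evaluate it at a
  point that separates the finitely many polynomials that occur.\<close>

lemma exists_additive_order:
  "\<exists>\<phi> :: ('g \<Rightarrow> 'k) \<Rightarrow> int. inj_on \<phi> (level i) \<and>
    (\<forall>\<gamma>\<in>weights. \<forall>\<delta>\<in>weights. \<forall>\<gamma>'\<in>weights. \<forall>\<delta>'\<in>weights.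
      \<gamma> + \<delta> = \<gamma>' + \<delta>' \<longrightarrow> \<phi> \<gamma> + \<phi> \<delta> = \<phi> \<gamma>' + \<phi> \<delta>')"
proof -
  obtain idx :: "('g \<Rightarrow> 'k) \<Rightarrow> nat" where idx: "inj_on idx B"
    using finite_imp_inj_to_nat_seg[OF finite_B] by blast
  define p where "p \<gamma> = (\<Sum>\<beta>\<in>B. monom (coeffs \<gamma> \<beta>) (idx \<beta>))" for \<gamma>
  have coeff_p: "coeff (p \<gamma>) (idx \<beta>) = coeffs \<gamma> \<beta>" if \<beta>: "\<beta> \<in> B" for \<gamma> \<beta>
  proof -
    have "coeff (p \<gamma>) (idx \<beta>) = (\<Sum>\<beta>'\<in>B. if \<beta>' = \<beta> then coeffs \<gamma> \<beta> else 0)"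
      unfolding p_def coeff_sum using \<beta> inj_onD[OF idx] by (intro sum.cong refl) auto
    then show ?thesis using \<beta> finite_B by (simp add: sum.delta)
  qed
  have inj_p: "inj_on p weights"
  proof (rule inj_onI)
    fix \<gamma> \<delta> assume *: "\<gamma> \<in> weights" "\<delta> \<in> weights" "p \<gamma> = p \<delta>"
    have "coeffs \<gamma> \<beta> = coeffs \<delta> \<beta>" for \<beta>
    proof (cases "\<beta> \<in> B")
      case True
      then show ?thesis using coeff_p[OF True, of \<gamma>] coeff_p[OF True, of \<delta>] *(3) by simp
    next
      case False
      then show ?thesis
        using root_expansion_coeffs[OF *(1)] root_expansion_coeffs[OF *(2)] by (simp add: is_root_expansion_def)
    qed
    then have "coeffs \<gamma> = coeffs \<delta>" by blast
    then show "\<gamma> = \<delta>"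
      using root_expansion_coeffs[OF *(1)] root_expansion_coeffs[OF *(2)] by (simp add: is_root_expansion_def)
  qed
  obtain m where m: "inj_on (\<lambda>q. poly q m) (p ` weights)"
    using exists_separating_point[of "p ` weights"] finite_weights by blast
  let ?\<phi> = "\<lambda>\<gamma>. poly (p \<gamma>) m"
  have "inj_on ?\<phi> weights" using comp_inj_on[OF inj_p m] by (simp add: o_def)
  then have "inj_on ?\<phi> (level i)" by (rule inj_on_subset) (auto simp: level_def)
  moreover have "?\<phi> \<gamma> + ?\<phi> \<delta> = ?\<phi> \<gamma>' + ?\<phi> \<delta>'"
    if "\<gamma> \<in> weights" "\<delta> \<in> weights" "\<gamma>' \<in> weights" "\<delta>' \<in> weights" "\<gamma> + \<delta> = \<gamma>' + \<delta>'" for \<gamma> \<delta> \<gamma>' \<delta>'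
  proof -
    have "is_root_expansion B (\<gamma> + \<delta>) (\<lambda>\<beta>. coeffs \<gamma> \<beta> + coeffs \<delta> \<beta>)"
      "is_root_expansion B (\<gamma> + \<delta>) (\<lambda>\<beta>. coeffs \<gamma>' \<beta> + coeffs \<delta>' \<beta>)"
      using root_expansion_add[OF root_expansion_coeffs[OF that(1)] root_expansion_coeffs[OF that(2)]]
        root_expansion_add[OF root_expansion_coeffs[OF that(3)] root_expansion_coeffs[OF that(4)]]
      by (simp_all only: that(5))
    from root_expansion_unique[OF this]
    have "coeffs \<gamma> \<beta> + coeffs \<delta> \<beta> = coeffs \<gamma>' \<beta> + coeffs \<delta>' \<beta>" for \<beta> by (rule fun_cong)
    then have "p \<gamma> + p \<delta> = p \<gamma>' + p \<delta>'"
      by (simp add: p_def sum.distrib[symmetric] add_monom)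
    then show ?thesis by (metis poly_add)
  qed
  ultimately show ?thesis by (intro exI[of _ ?\<phi>]) blast
qed

lemma graded_part_eq: "graded_part T B \<alpha> 1 = range (proj (level 1))"
proof
  have "subspace (range (proj (level 1)))" by (rule subspace_image_endo[OF endo_proj subspace_UNIV])
  moreover have "root_space T \<gamma> \<subseteq> range (proj (level 1))" if \<gamma>: "\<gamma> \<in> level 1" for \<gamma>
  proof
    fix x assume "x \<in> root_space T \<gamma>"
    then have "proj (level 1) x = x"
      using \<gamma> level_1_roots root_space_eq[of \<gamma>] by (subst proj_weight_vector[of \<gamma>]) (auto simp: roots_weights)
    then show "x \<in> range (proj (level 1))" by (metis rangeI)
  qed
  ultimately show "graded_part T B \<alpha> 1 \<subseteq> range (proj (level 1))"
    unfolding graded_part_def roots_of_height_eq by (intro span_minimal) auto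
  show "range (proj (level 1)) \<subseteq> graded_part T B \<alpha> 1"
  proof (rule image_subsetI)
    fix x
    have "proj {\<gamma>} x \<in> graded_part T B \<alpha> 1" if "\<gamma> \<in> level 1" for \<gamma>
      unfolding graded_part_def roots_of_height_eq
      using that proj_in_weight_space[of \<gamma> x] root_space_eq[of \<gamma>] level_1_roots by (intro span_base) auto
    then show "proj (level 1) x \<in> graded_part T B \<alpha> 1"
      unfolding proj_sum_singletons[of "level 1"] level_weights
      by (intro subspace_sum) (auto simp: graded_part_def)
  qed
qed

lemma dim_range_proj:
  assumes "M \<subseteq> level 1"
  shows "dim (range (proj M)) = card M"
proof -
  have M: "M \<inter> weights = M" using assms by (auto simp: level_def)
  have "of_nat (dim (range (proj M))) = trace (proj M)" by (rule trace_proj[symmetric])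
  also have "\<dots> = (\<Sum>\<nu>\<in>M. trace (proj {\<nu>}))"
    using trace_compose_proj[OF endo_ident, of M] by (simp add: M)
  also have "\<dots> = (\<Sum>\<nu>\<in>M. 1)"
  proof (rule sum.cong[OF refl])
    fix \<nu> assume "\<nu> \<in> M"
    then have "\<nu> \<in> roots T" using assms level_1_roots by blast
    then show "trace (proj {\<nu>}) = 1"
      using trace_proj_weight[of \<nu>] mult_root[of \<nu>] roots_weights[of \<nu>] roots_nonzero[of \<nu>] by simp
  qed
  also have "\<dots> = (of_nat (card M) :: 'k)" by simp
  finally show ?thesis by (simp only: of_nat_eq_iff)
qed

text \<open>Order the roots of the first graded part by \<open>\<phi>\<close>. The leading roots of elements of \<open>A\<close> form a set \<open>S\<close>, and
  the root spaces outside \<open>S\<close> span a complement of \<open>A\<close>, as in Gaussian elimination. Since \<open>\<phi>\<close> is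
  additive, \<open>[A,A] = 0\<close> forces the brackets of leading root vectors to vanish.\<close>

lemma half_dimensional_complement:
  assumes A: "abelian_subspace (graded_part T B \<alpha> 1) A"
    and half: "dim (graded_part T B \<alpha> 1) = 2 * dim A"
  shows "\<exists>A'. abelian_subspace (graded_part T B \<alpha> 1) A' \<and> is_direct_sum A A' (graded_part T B \<alpha> 1)"
proof -
  let ?L = "level 1" and ?V = "range (proj (level 1))"
  have subA: "subspace A" and AV: "A \<subseteq> ?V" and abA: "\<And>x y. x \<in> A \<Longrightarrow> y \<in> A \<Longrightarrow> bracket x y = 0"
    using A by (auto simp: abelian_subspace_def graded_part_eq)
  have subV: "subspace (range (proj M))" for M by (rule subspace_image_endo[OF endo_proj subspace_UNIV])
  have L: "\<gamma> \<in> weights" "\<gamma> \<in> roots T" if "\<gamma> \<in> ?L" for \<gamma>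
    using that level_1_roots by (auto simp: level_def)
  have expand: "(\<Sum>\<gamma>\<in>M. proj {\<gamma>} x) = x" if "x \<in> range (proj M)" "M \<subseteq> ?L" for x M
  proof -
    from that obtain y where "x = proj M y" by blast
    then have "proj M x = x" by (simp add: proj_proj)
    moreover have "M \<inter> weights = M" using that L by blast
    ultimately show ?thesis using proj_sum_singletons[of M x] by simp
  qed
  obtain \<phi> :: "('g \<Rightarrow> 'k) \<Rightarrow> int" where inj: "inj_on \<phi> ?L"
    and add: "\<And>\<gamma> \<delta> \<gamma>' \<delta>'. \<lbrakk>\<gamma> \<in> weights; \<delta> \<in> weights; \<gamma>' \<in> weights; \<delta>' \<in> weights; \<gamma> + \<delta> = \<gamma>' + \<delta>'\<rbrakk>
      \<Longrightarrow> \<phi> \<gamma> + \<phi> \<delta> = \<phi> \<gamma>' + \<phi> \<delta>'"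
    using exists_additive_order[of 1] by blast
  define leads where "leads x \<gamma> \<longleftrightarrow> \<gamma> \<in> ?L \<and> proj {\<gamma>} x \<noteq> 0 \<and> (\<forall>\<delta>\<in>?L. proj {\<delta>} x \<noteq> 0 \<longrightarrow> \<phi> \<delta> \<le> \<phi> \<gamma>)"
    for x \<gamma>
  define S where "S = {\<gamma>. \<exists>x\<in>A. leads x \<gamma>}"
  define C where "C = range (proj (?L - S))"
  have SL: "S \<subseteq> ?L" by (auto simp: S_def leads_def)
  have subC: "subspace C" unfolding C_def by (rule subV)
  have CV: "C \<subseteq> ?V"
  proof
    fix x assume "x \<in> C"
    then obtain y where "x = proj (?L - S) y" by (auto simp: C_def)
    moreover have "?L \<inter> (?L - S) = ?L - S" by blast
    ultimately have "x = proj ?L x" by (simp add: proj_proj)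
    then show "x \<in> ?V" by blast
  qed
  have lead_exists: "\<exists>\<gamma>. leads x \<gamma>" if "x \<in> A" "x \<noteq> 0" for x
  proof -
    let ?supp = "{\<gamma> \<in> ?L. proj {\<gamma>} x \<noteq> 0}"
    have "?supp \<noteq> {}"
    proof
      assume "?supp = {}"
      then have "(\<Sum>\<gamma>\<in>?L. proj {\<gamma>} x) = 0" by (intro sum.neutral) blast
      then show False using expand[of x ?L] that AV by auto
    qed
    moreover have fin: "finite ?supp" using finite_level by simp
    ultimately have "Max (\<phi> ` ?supp) \<in> \<phi> ` ?supp" by (intro Max_in) auto
    then obtain \<gamma> where "\<gamma> \<in> ?supp" "\<phi> \<gamma> = Max (\<phi> ` ?supp)" by auto
    then have "leads x \<gamma>" unfolding leads_def using fin by auto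
    then show ?thesis by blast
  qed
  have AC: "A \<inter> C = {0}"
  proof -
    have "x = 0" if x: "x \<in> A" "x \<in> C" for x
    proof (rule ccontr)
      assume "x \<noteq> 0"
      then obtain \<gamma> where \<gamma>: "leads x \<gamma>" using lead_exists x by blast
      then have "\<gamma> \<in> S" using x by (auto simp: S_def)
      obtain y where "x = proj (?L - S) y" using x by (auto simp: C_def)
      then have "proj {\<gamma>} x = proj ({\<gamma>} \<inter> (?L - S)) y" by (simp add: proj_proj)
      also have "{\<gamma>} \<inter> (?L - S) = {}" using \<open>\<gamma> \<in> S\<close> by blast
      finally show False using \<gamma> by (simp add: leads_def proj_def)
    qed
    then show ?thesis using subspace_0[OF subA] subspace_0[OF subC] by blast
  qed
  let ?U = "{x + y | x y. x \<in> A \<and> y \<in> C}"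
  have subU: "subspace ?U" by (rule subspace_sums[OF subA subC])
  have UI: "x \<in> ?U" if "x \<in> A \<or> x \<in> C" for x
  proof -
    have "x = x + 0" "x = 0 + x" by simp_all
    then show ?thesis using that subspace_0[OF subA] subspace_0[OF subC] by blast
  qed
  have root_U: "weight_space \<gamma> \<subseteq> ?U" if "\<gamma> \<in> ?L" for \<gamma>
    using that
  proof (induction "card {\<delta> \<in> ?L. \<phi> \<delta> < \<phi> \<gamma>}" arbitrary: \<gamma> rule: less_induct)
    case (less \<gamma>)
    show ?case
    proof (cases "\<gamma> \<in> S")
      case False
      have "x \<in> C" if "x \<in> weight_space \<gamma>" for x
      proof -
        have "proj (?L - S) x = x" using proj_weight_vector[OF L(1)[OF less.prems] that] False less.prems by simp
        then show ?thesis unfolding C_def by (metis rangeI)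
      qed
      then show ?thesis using UI by blast
    next
      case True
      then obtain x where x: "x \<in> A" "leads x \<gamma>" by (auto simp: S_def)
      have "proj {\<delta>} x \<in> ?U" if \<delta>: "\<delta> \<in> ?L - {\<gamma>}" for \<delta>
      proof (cases "proj {\<delta>} x = 0")
        case False
        then have "\<phi> \<delta> \<le> \<phi> \<gamma>" using x(2) \<delta> by (auto simp: leads_def)
        moreover have "\<phi> \<delta> \<noteq> \<phi> \<gamma>" using inj_onD[OF inj, of \<delta> \<gamma>] \<delta> less.prems by blast
        ultimately have lt: "\<phi> \<delta> < \<phi> \<gamma>" by simp
        have "{\<kappa> \<in> ?L. \<phi> \<kappa> < \<phi> \<delta>} \<subset> {\<kappa> \<in> ?L. \<phi> \<kappa> < \<phi> \<gamma>}" using lt \<delta> by force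
        then have "card {\<kappa> \<in> ?L. \<phi> \<kappa> < \<phi> \<delta>} < card {\<kappa> \<in> ?L. \<phi> \<kappa> < \<phi> \<gamma>}"
          using finite_level by (intro psubset_card_mono) auto
        then have "weight_space \<delta> \<subseteq> ?U" using \<delta> by (intro less.hyps) auto
        then show ?thesis using proj_in_weight_space by blast
      qed (use subspace_0[OF subU] in simp)
      then have "(\<Sum>\<delta>\<in>?L - {\<gamma>}. proj {\<delta>} x) \<in> ?U" by (rule subspace_sum[OF subU])
      then have "x - (\<Sum>\<delta>\<in>?L - {\<gamma>}. proj {\<delta>} x) \<in> ?U" using UI x by (intro subspace_diff[OF subU]) auto
      moreover have "(\<Sum>\<delta>\<in>?L. proj {\<delta>} x) = x" using expand[of x ?L] x AV by auto
      then have "x - (\<Sum>\<delta>\<in>?L - {\<gamma>}. proj {\<delta>} x) = proj {\<gamma>} x"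
        using less.prems finite_level[of 1] by (simp add: sum.remove[of ?L \<gamma>] diff_eq_eq)
      ultimately have in_U: "proj {\<gamma>} x \<in> ?U" by (simp only:)
      show ?thesis
      proof
        fix y assume "y \<in> weight_space \<gamma>"
        then obtain c where "y = c *s proj {\<gamma>} x"
          using weight_space_line[OF L(1)[OF less.prems] roots_nonzero[OF L(2)[OF less.prems]] proj_in_weight_space]
            x(2) by (auto simp: leads_def)
        then show "y \<in> ?U" using subspace_scale[OF subU in_U] by simp
      qed
    qed
  qed
  have U: "?U = ?V"
  proof
    show "?U \<subseteq> ?V" using AV CV subspace_add[OF subV[of ?L]] by blast
    show "?V \<subseteq> ?U"
    proof
      fix x assume "x \<in> ?V"
      then have "x = (\<Sum>\<gamma>\<in>?L. proj {\<gamma>} x)" using expand[of x ?L] by simp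
      also have "\<dots> \<in> ?U" using root_U proj_in_weight_space by (intro subspace_sum[OF subU]) blast
      finally show "x \<in> ?U" .
    qed
  qed
  have "card ?L = 2 * card S"
  proof -
    have "dim ?V = card ?L" by (rule dim_range_proj) simp
    moreover have "dim C = card (?L - S)" unfolding C_def by (rule dim_range_proj) blast
    moreover have "dim ?U + dim (A \<inter> C) = dim A + dim C" by (rule dim_sums_Int[OF subA subC])
    moreover have "card (?L - S) + card S = card ?L"
      using SL finite_level[of 1] by (metis add.commute card_Diff_subset card_mono finite_subset le_add_diff_inverse)
    ultimately show ?thesis using half unfolding AC U graded_part_eq by simp
  qed
  moreover have "bracket (root_vec \<gamma>) (root_vec \<delta>) = 0" if \<gamma>: "\<gamma> \<in> S" and \<delta>: "\<delta> \<in> S" for \<gamma> \<delta>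
  proof -
    from \<gamma> obtain x where x: "x \<in> A" "leads x \<gamma>" by (auto simp: S_def)
    from \<delta> obtain y where y: "y \<in> A" "leads y \<delta>" by (auto simp: S_def)
    note \<gamma>L = subsetD[OF SL \<gamma>] and \<delta>L = subsetD[OF SL \<delta>]
    \<comment> \<open>The part of \<open>[x,y]\<close> of weight \<open>\<gamma> + \<delta>\<close> only comes from the leading terms.\<close>
    have part: "proj {\<gamma> + \<delta>} (bracket (proj {\<gamma>'} x) (proj {\<delta>'} y)) =
        (if \<gamma>' = \<gamma> then if \<delta>' = \<delta> then bracket (proj {\<gamma>} x) (proj {\<delta>} y) else 0 else 0)"
      if "\<gamma>' \<in> ?L" "\<delta>' \<in> ?L" for \<gamma>' \<delta>'
    proof -
      have off: "vanishes_off_T (\<gamma>' + \<delta>')" 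
        using weights_vanish[OF L(1)[OF that(1)]] weights_vanish[OF L(1)[OF that(2)]] by simp
      have "bracket (proj {\<gamma>'} x) (proj {\<delta>'} y) \<in> weight_space (\<gamma>' + \<delta>')"
        by (intro bracket_weight_space proj_in_weight_space)
      then have proj: "proj {\<gamma> + \<delta>} (bracket (proj {\<gamma>'} x) (proj {\<delta>'} y)) =
          (if \<gamma>' + \<delta>' = \<gamma> + \<delta> then bracket (proj {\<gamma>'} x) (proj {\<delta>'} y) else 0)"
        by (subst proj_weight_vector_vanishing[OF off]) auto
      show ?thesis
      proof (cases "\<gamma>' + \<delta>' = \<gamma> + \<delta> \<and> proj {\<gamma>'} x \<noteq> 0 \<and> proj {\<delta>'} y \<noteq> 0")
        case True
        then have "\<phi> \<gamma>' \<le> \<phi> \<gamma>" "\<phi> \<delta>' \<le> \<phi> \<delta>" using x y that by (auto simp: leads_def)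
        moreover have "\<phi> \<gamma>' + \<phi> \<delta>' = \<phi> \<gamma> + \<phi> \<delta>" using True that \<gamma>L \<delta>L L by (intro add) auto
        ultimately have "\<phi> \<gamma>' = \<phi> \<gamma>" "\<phi> \<delta>' = \<phi> \<delta>" by linarith+
        then have "\<gamma>' = \<gamma>" "\<delta>' = \<delta>" using inj_onD[OF inj] that \<gamma>L \<delta>L by blast+
        then show ?thesis using proj by simp
      next
        case False
        then show ?thesis using proj x(2) y(2) by (auto simp: leads_def)
      qed
    qed
    have "bracket x y = bracket (\<Sum>\<gamma>'\<in>?L. proj {\<gamma>'} x) (\<Sum>\<delta>'\<in>?L. proj {\<delta>'} y)"
      by (simp only: expand[OF subsetD[OF AV x(1)] order_refl] expand[OF subsetD[OF AV y(1)] order_refl])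
    also have "\<dots> = (\<Sum>\<gamma>'\<in>?L. \<Sum>\<delta>'\<in>?L. bracket (proj {\<gamma>'} x) (proj {\<delta>'} y))"
      by (subst bracket_sum_left) (simp only: bracket_sum_right)
    finally have "proj {\<gamma> + \<delta>} (bracket x y) =
        (\<Sum>\<gamma>'\<in>?L. \<Sum>\<delta>'\<in>?L. proj {\<gamma> + \<delta>} (bracket (proj {\<gamma>'} x) (proj {\<delta>'} y)))"
      by (simp only: endo_sum[OF endo_proj])
    also have "\<dots> = (\<Sum>\<gamma>'\<in>?L. \<Sum>\<delta>'\<in>?L. if \<gamma>' = \<gamma> then if \<delta>' = \<delta> then bracket (proj {\<gamma>} x) (proj {\<delta>} y) else 0 else 0)"
      by (intro sum.cong refl part)
    also have "\<dots> = (\<Sum>\<gamma>'\<in>?L. if \<gamma>' = \<gamma> then bracket (proj {\<gamma>} x) (proj {\<delta>} y) else 0)"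
      using finite_level[of 1] \<delta>L by (intro sum.cong refl) (auto simp: sum.delta)
    also have "\<dots> = bracket (proj {\<gamma>} x) (proj {\<delta>} y)"
      using finite_level[of 1] \<gamma>L by (simp add: sum.delta)
    finally have "bracket (proj {\<gamma>} x) (proj {\<delta>} y) = 0"
      using abA[OF x(1) y(1)] by (simp add: endo_0[OF endo_proj])
    then show ?thesis
      using x(2) y(2) L(2)[OF \<gamma>L] L(2)[OF \<delta>L]
      by (auto simp: leads_def proj_root bracket_scale_left bracket_scale_right)
  qed
  ultimately have comm: "bracket (root_vec \<gamma>) (root_vec \<delta>) = 0" if "\<gamma> \<in> ?L - S" "\<delta> \<in> ?L - S" for \<gamma> \<delta>
    using half_commuting_complement[OF SL] that by blast
  have "bracket x y = 0" if xy: "x \<in> C" "y \<in> C" for x y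
  proof -
    have "bracket x y = bracket (\<Sum>\<gamma>\<in>?L - S. proj {\<gamma>} x) (\<Sum>\<delta>\<in>?L - S. proj {\<delta>} y)"
      using expand[of x "?L - S"] expand[of y "?L - S"] xy by (auto simp: C_def)
    also have "\<dots> = (\<Sum>\<gamma>\<in>?L - S. \<Sum>\<delta>\<in>?L - S. bracket (proj {\<gamma>} x) (proj {\<delta>} y))"
      by (subst bracket_sum_left) (simp only: bracket_sum_right)
    also have "\<dots> = 0"
      using L(2) comm by (intro sum.neutral ballI) (simp add: proj_root bracket_scale_left bracket_scale_right)
    finally show ?thesis .
  qed
  then have "abelian_subspace ?V C" using subC CV by (auto simp: abelian_subspace_def)
  moreover have "is_direct_sum A C ?V" unfolding is_direct_sum_def using AC U by blast
  ultimately show ?thesis unfolding graded_part_eq by blast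
qed

end

theorem theorem5p4:
  fixes scale :: "'k::{alg_closed_field, field_char_0} \<Rightarrow> 'g::ab_group_add \<Rightarrow> 'g"
    and bracket :: "'g \<Rightarrow> 'g \<Rightarrow> 'g"
    and T :: "'g set"
    and B :: "('g \<Rightarrow> 'k) set"
    and \<alpha> :: "'g \<Rightarrow> 'k"
    and A :: "'g set"
  defines "g1 \<equiv> lie_algebra.graded_part scale bracket T B \<alpha> 1"
  assumes "simple_lie_algebra scale bracket"
    and "lie_algebra.cartan_subalgebra scale bracket T"
    and "lie_algebra.simple_roots scale bracket T B"
    and "\<alpha> \<in> B"
    and "lie_algebra.abelian_subspace scale bracket g1 A"
    and "real (vector_space.dim scale A) = 1 / 2 * real (vector_space.dim scale g1)"
  shows "\<exists>A'. lie_algebra.abelian_subspace scale bracket g1 A' \<and>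
              is_direct_sum A A' g1"
proof -
  interpret L: simple_lie_algebra scale bracket by fact
  obtain X where X: "finite X" "L.span X = UNIV" using L.finite_dimensional by blast
  obtain Basis where Basis: "Basis \<subseteq> X" "L.independent Basis" "X \<subseteq> L.span Basis"
    by (rule L.maximal_independent_subset[of X])
  have "L.span Basis = UNIV"
    using L.span_minimal[OF Basis(3) L.subspace_span] X(2) by blast
  then interpret graded_simple scale Basis bracket T B \<alpha>
    using Basis X finite_subset assms by unfold_locales auto
  have "L.dim g1 = 2 * L.dim A" using assms(7) by linarith
  then show ?thesis
    using half_dimensional_complement[of A] assms(6) unfolding g1_def by blast
qed

end
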